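(* For $\beta_1\ge 0$ and $\beta_2\in\mathbb{R}$ let $u_{\beta_1,\beta_2}(x)=x^4-\beta_1x^2+\beta_2x$, $x\in\mathbb{R}$. Then for every $\beta_1\ge0$, $$4e^{14}\exp\Big[-\tfrac14\beta_1^2+2\log(1+\beta_1)\Big]\ \ge\ \inf_{\beta_2\in\mathbb{R}}\lambda_1(u_{\beta_1,\beta_2})\ \ge\ \inf_{\beta_2\in\mathbb{R}}\sigma(u_{\beta_1,\beta_2})\ \ge\ \frac{\sqrt{\beta_1^2+8}-\beta_1}{\sqrt e}\exp\Big[-\tfrac18\beta_1\Big(\beta_1+\sqrt{\beta_1^2+8}\Big)\Big].$$ In particular, $\inf_{\beta_2}\lambda_1(u_{\beta_1,\beta_2})$ and $\inf_{\beta_2}\sigma(u_{\beta_1,\beta_2})$ are both of the form $\exp[-\beta_1^2/4+O(\log\beta_1)]$ as $\beta_1\to\infty$.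
   Context: For $u\in C^\infty(\mathbb{R})$ with $Z=\int_{\mathbb{R}}e^{-u}dx<\infty$, let $d\mu=e^{-u}dx/Z$ and $D(f)=\int_{\mathbb{R}}(f')^2d\mu$. The spectral gap $\lambda_1(u)$ is the largest constant $\kappa$ such that $\kappa\,\mathrm{Var}_\mu(f)\le D(f)$ for all $f\in C_0^\infty(\mathbb{R})$. The logarithmic Sobolev constant $\sigma(u)$ is the largest constant $\sigma$ such that $\sigma\,\mathrm{Ent}_\mu(f^2)\le 2D(f)$ for all $f$ in the domain of the Dirichlet form $D$ (equivalently, for all $f\in C_0^\infty(\mathbb{R})$), where $\mathrm{Ent}_\mu(g)=\mu(g\log g)-\mu(g)\log\mu(g)$ for $g\ge0$ and $\mu(g)=\int g\,d\mu$. *)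

theory Defs
  imports "HOL-Probability.Probability" "HOL-Library.Landau_Symbols"
begin

definition smooth :: "(real \<Rightarrow> real) \<Rightarrow> bool" where
  "smooth f \<longleftrightarrow> (\<forall>n. (deriv ^^ n) f differentiable_on UNIV)"

definition test_functions :: "(real \<Rightarrow> real) set" where
  "test_functions = {f. smooth f \<and> compact (closure {x. f x \<noteq> 0})}"

definition partition_function :: "(real \<Rightarrow> real) \<Rightarrow> real" where
  "partition_function u = (LINT x|lborel. exp (- u x))"

definition gibbs :: "(real \<Rightarrow> real) \<Rightarrow> real measure" where
  "gibbs u = density lborel (\<lambda>x. ennreal (exp (- u x) / partition_function u))"

definition dirichlet_form :: "(real \<Rightarrow> real) \<Rightarrow> (real \<Rightarrow> real) \<Rightarrow> real" where
  "dirichlet_form u f = (LINT x|gibbs u. (deriv f x)\<^sup>2)"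

text \<open>The convention \<open>0 log 0 = 0\<close> is provided by \<open>ln 0 = 0\<close>.\<close>

definition Ent :: "'a measure \<Rightarrow> ('a \<Rightarrow> real) \<Rightarrow> real" where
  "Ent M g = (LINT x|M. g x * ln (g x)) - (LINT x|M. g x) * ln (LINT x|M. g x)"

text \<open>
  In the next two definitions the optimal constant is a maximum, not merely a supremum:
  the set of admissible constants is closed, contains \<open>0\<close>, and is bounded above as soon as
  some test function has positive variance (resp. its square has positive entropy).
\<close>

definition spectral_gap :: "(real \<Rightarrow> real) \<Rightarrow> real" where
  "spectral_gap u =
    (GREATEST \<kappa>. \<forall>f\<in>test_functions. \<kappa> * prob_space.variance (gibbs u) f \<le> dirichlet_form u f)"

definition log_sobolev :: "(real \<Rightarrow> real) \<Rightarrow> real" where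
  "log_sobolev u =
    (GREATEST \<sigma>. \<forall>f\<in>test_functions. \<sigma> * Ent (gibbs u) (\<lambda>x. (f x)\<^sup>2) \<le> 2 * dirichlet_form u f)"

definition quartic :: "real \<Rightarrow> real \<Rightarrow> real \<Rightarrow> real" where
  "quartic \<beta>1 \<beta>2 x = x ^ 4 - \<beta>1 * x\<^sup>2 + \<beta>2 * x"

text \<open>
  \<open>F\<close> is of the form \<open>exp (- \<beta>\<^sup>2 / 4 + O(log \<beta>))\<close> as \<open>\<beta> \<rightarrow> \<infinity>\<close>.
\<close>

definition exp_quarter_square_form :: "(real \<Rightarrow> real) \<Rightarrow> bool" where
  "exp_quarter_square_form F \<longleftrightarrow>
    (\<exists>r. r \<in> O[at_top](ln) \<and> (\<forall>\<^sub>F \<beta> in at_top. F \<beta> = exp (- \<beta>\<^sup>2 / 4 + r \<beta>)))"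

end

theory Submission
  imports Defs "HOL-Real_Asymp.Real_Asymp"
begin

text \<open>
The lower bound rests on convexity up to a bounded perturbation. For \<open>K > 0\<close> put
\<open>c = (\<beta>1 + K/2)/2\<close>; then, up to a constant, the quartic is \<open>K x\<^sup>2/2 + \<beta>2 x + (x\<^sup>2 - c)\<^sup>2\<close>, and
replacing \<open>(x\<^sup>2 - c)\<^sup>2\<close> by \<open>0\<close> where \<open>x\<^sup>2 < c\<close> leaves a potential \<open>V\<close> whose graph lies above
its tangents by at least \<open>K/2\<close> times the squared distance, and changes the quartic by
a function \<open>h\<close> of oscillation \<open>c\<^sup>2\<close>. The Bakry--Emery inequality gives the logarithmic Sobolev
constant \<open>K\<close> for \<open>V\<close>, the Holley--Stroock argument costs a factor \<open>exp(-c\<^sup>2)\<close>, and optimising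
over \<open>K\<close> produces exactly the stated bound (\<open>log_sobolev_quartic_ge\<close>,
\<open>log_sobolev_quartic_lower_bound\<close>).

In one dimension the Bakry--Emery inequality has a short proof by monotone transport
(\<open>transport_entropy_bound\<close>): the map that pushes \<open>\<rho> exp(-V)\<close> to \<open>exp(-V)\<close> turns the entropy into an
expression to which convexity and one integration by parts apply. On a compact interval the
transport fixes the end points, and everything is elementary calculus; the inequality on the line
follows by letting the interval grow (\<open>log_sobolev_from_intervals\<close>).

The comparison between the two constants is the usual linearisation: the logarithmic Sobolev
inequality for \<open>1 + \<epsilon>\<phi>\<close> becomes, to second order in \<open>\<epsilon>\<close>, the Poincare inequality for \<open>\<phi>\<close>
(\<open>log_sobolev_imp_poincare\<close>). The upper bound takes \<open>\<beta>2 = 0\<close>, a symmetric double well, and tests the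
Poincare inequality on a smooth step across the barrier (\<open>poincare_constant_le\<close>,
\<open>spectral_gap_quartic_upper_bound\<close>). Neither function has compact support; both are reached from
test functions by smooth cutoffs and dominated convergence (\<open>cutoff_integral_tendsto\<close>), and the same
step function shows that the optimal constants exist as maxima.
\<close>

section \<open>Smooth functions, steps and cutoffs\<close>

lemma smooth_iff:
  "smooth f \<longleftrightarrow> (\<forall>x. (f has_real_derivative deriv f x) (at x)) \<and> smooth (deriv f)"
proof
  assume s: "smooth f"
  have "(f has_real_derivative deriv f x) (at x)" for x
    using s[unfolded smooth_def, rule_format, of 0]
    by (auto simp: differentiable_on_def DERIV_deriv_iff_real_differentiable)
  moreover have "smooth (deriv f)"
    unfolding smooth_def
  proof
    fix n
    show "(deriv ^^ n) (deriv f) differentiable_on UNIV"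
      using s[unfolded smooth_def, rule_format, of "Suc n"] by (simp add: funpow_swap1)
  qed
  ultimately show "(\<forall>x. (f has_real_derivative deriv f x) (at x)) \<and> smooth (deriv f)" by blast
next
  assume a: "(\<forall>x. (f has_real_derivative deriv f x) (at x)) \<and> smooth (deriv f)"
  show "smooth f"
    unfolding smooth_def
  proof
    fix n
    show "(deriv ^^ n) f differentiable_on UNIV"
    proof (cases n)
      case 0
      then show ?thesis using a
        by (auto simp: differentiable_on_def real_differentiable_def)
    next
      case (Suc m)
      then show ?thesis using a unfolding smooth_def by (simp add: funpow_swap1)
    qed
  qed
qed

lemma smoothD:
  assumes "smooth f"
  shows "(f has_real_derivative deriv f x) (at x)" and "smooth (deriv f)"
  using assms[unfolded smooth_iff[of f]] by blast+

text \<open>A coinduction principle for smoothness: a family of functions that is closed under taking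
derivatives consists of smooth functions, because all iterated derivatives stay in the family.
Every closure property below only requires a suitable family.\<close>

lemma smooth_coinduct:
  assumes "f \<in> S"
    and step: "\<And>g. g \<in> S \<Longrightarrow> \<exists>g'\<in>S. \<forall>x. (g has_real_derivative g' x) (at x)"
  shows "smooth f"
proof -
  have mem: "(deriv ^^ n) f \<in> S" for n
  proof (induction n)
    case (Suc n)
    obtain g' where g': "g' \<in> S" "\<forall>x. ((deriv ^^ n) f has_real_derivative g' x) (at x)"
      using step[OF Suc] by blast
    then have "deriv ((deriv ^^ n) f) = g'" by (intro ext DERIV_imp_deriv) auto
    then show ?case using g' by simp
  qed (simp add: assms)
  show ?thesis
    unfolding smooth_def
  proof
    fix n
    obtain g' where "\<forall>x. ((deriv ^^ n) f has_real_derivative g' x) (at x)"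
      using step[OF mem[of n]] by blast
    then show "(deriv ^^ n) f differentiable_on UNIV"
      by (auto simp: differentiable_on_def real_differentiable_def)
  qed
qed

lemma smooth_of_derivative:
  assumes "\<And>x. (f has_real_derivative g x) (at x)" "smooth g"
  shows "smooth f" and "deriv f = g"
proof -
  show d: "deriv f = g" using assms by (intro ext DERIV_imp_deriv) auto
  show "smooth f" using assms by (subst smooth_iff) (simp add: d)
qed

lemma smooth_const: "smooth (\<lambda>x. c)"
  by (rule smooth_coinduct[where S = "{\<lambda>x. c |c. True}"]) (auto intro!: derivative_eq_intros)

text \<open>By the product rule, derivatives of products are sums of products; the sums and products generated by
smooth functions are therefore a family to which coinduction applies.\<close>

inductive_set smooth_ring :: "(real \<Rightarrow> real) set" where
  base: "smooth f \<Longrightarrow> f \<in> smooth_ring"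
| add: "f \<in> smooth_ring \<Longrightarrow> g \<in> smooth_ring \<Longrightarrow> (\<lambda>x. f x + g x) \<in> smooth_ring"
| mult: "f \<in> smooth_ring \<Longrightarrow> g \<in> smooth_ring \<Longrightarrow> (\<lambda>x. f x * g x) \<in> smooth_ring"

lemma smooth_ring_derivative:
  "g \<in> smooth_ring \<Longrightarrow> \<exists>g'\<in>smooth_ring. \<forall>x. (g has_real_derivative g' x) (at x)"
proof (induction rule: smooth_ring.induct)
  case (base f)
  then show ?case by (intro bexI[of _ "deriv f"]) (auto simp: smoothD smooth_ring.base)
next
  case (add f g)
  then obtain f' g' where "f' \<in> smooth_ring" "g' \<in> smooth_ring"
    "\<forall>x. (f has_real_derivative f' x) (at x)" "\<forall>x. (g has_real_derivative g' x) (at x)"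
    by blast
  then show ?case
    by (intro bexI[of _ "\<lambda>x. f' x + g' x"]) (auto intro!: derivative_eq_intros smooth_ring.add)
next
  case (mult f g)
  then obtain f' g' where *: "f' \<in> smooth_ring" "g' \<in> smooth_ring"
    "\<forall>x. (f has_real_derivative f' x) (at x)" "\<forall>x. (g has_real_derivative g' x) (at x)"
    by blast
  have "(\<lambda>x. f' x * g x + f x * g' x) \<in> smooth_ring"
    using * mult by (intro smooth_ring.add smooth_ring.mult)
  moreover have "((\<lambda>x. f x * g x) has_real_derivative f' x * g x + f x * g' x) (at x)" for x
    using * by (auto intro!: derivative_eq_intros)
  ultimately show ?case by (intro bexI[of _ "\<lambda>x. f' x * g x + f x * g' x"]) auto
qed

lemma smooth_ring_smooth: "f \<in> smooth_ring \<Longrightarrow> smooth f"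
  by (rule smooth_coinduct[where S = smooth_ring]) (use smooth_ring_derivative in auto)

lemma smooth_add: "smooth f \<Longrightarrow> smooth g \<Longrightarrow> smooth (\<lambda>x. f x + g x)"
  by (rule smooth_ring_smooth[OF smooth_ring.add[OF smooth_ring.base smooth_ring.base]])

lemma smooth_mult: "smooth f \<Longrightarrow> smooth g \<Longrightarrow> smooth (\<lambda>x. f x * g x)"
  by (rule smooth_ring_smooth[OF smooth_ring.mult[OF smooth_ring.base smooth_ring.base]])

lemma smooth_compose_affine:
  assumes "smooth f"
  shows "smooth (\<lambda>x. f (a * x + b))"
proof (rule smooth_coinduct)
  show "(\<lambda>x. f (a * x + b)) \<in> {\<lambda>x. k * f (a * x + b) |k f. smooth f}"
    by (rule CollectI, rule exI[of _ 1], rule exI[of _ f]) (use assms in auto)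
next
  fix g assume "g \<in> {\<lambda>x. k * f (a * x + b) |k f. smooth f}"
  then obtain k f where g: "g = (\<lambda>x. k * f (a * x + b))" and f: "smooth f" by blast
  have "(g has_real_derivative (k * a) * deriv f (a * x + b)) (at x)" for x
  proof -
    have "((\<lambda>x. a * x + b) has_real_derivative a) (at x)" by (auto intro!: derivative_eq_intros)
    from DERIV_cmult[OF DERIV_chain2[OF smoothD(1)[OF f] this], of k]
    show ?thesis by (simp add: g mult_ac)
  qed
  moreover have "(\<lambda>x. (k * a) * deriv f (a * x + b)) \<in> {\<lambda>x. k * f (a * x + b) |k f. smooth f}"
    using smoothD(2)[OF f] by blast
  ultimately show "\<exists>g'\<in>{\<lambda>x. k * f (a * x + b) |k f. smooth f}. \<forall>x. (g has_real_derivative g' x) (at x)"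
    by (intro bexI[of _ "\<lambda>x. (k * a) * deriv f (a * x + b)"]) auto
qed

lemma smooth_continuous: "smooth f \<Longrightarrow> continuous_on A f"
  by (metis DERIV_continuous_on has_field_derivative_at_within smoothD(1))

lemma poly_exp_neg_inverse_tendsto_0:
  fixes p :: "real poly"
  shows "((\<lambda>x. poly p (1 / x) * exp (- 1 / x)) \<longlongrightarrow> 0) (at_right 0)"
proof -
  have "((\<lambda>x. \<Sum>i\<le>degree p. coeff p i * ((1 / x) ^ i * exp (- 1 / x))) \<longlongrightarrow> (\<Sum>i\<le>degree p. coeff p i * 0)) (at_right 0)"
  proof (intro tendsto_intros)
    fix i
    have "((\<lambda>y::real. y ^ i / exp y) \<longlongrightarrow> 0) at_top"
      by (rule tendsto_power_div_exp_0)
    then have "((\<lambda>x::real. (inverse x) ^ i / exp (inverse x)) \<longlongrightarrow> 0) (at_right 0)"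
      by (rule filterlim_compose) (rule filterlim_inverse_at_top_right)
    then show "((\<lambda>x::real. (1 / x) ^ i * exp (- 1 / x)) \<longlongrightarrow> 0) (at_right 0)"
      by (simp add: exp_minus field_simps)
  qed
  then show ?thesis by (simp add: poly_altdef sum_distrib_right mult.assoc)
qed

text \<open>The extensions by \<open>0\<close> of \<open>p(1/x) exp(-1/x)\<close>, with \<open>p\<close> ranging over all polynomials, are closed under
differentiation. This gives the smoothness at \<open>0\<close> of the standard flat function
\<open>flat_exp 1\<close>.\<close>

definition flat_exp :: "real poly \<Rightarrow> real \<Rightarrow> real" where
  "flat_exp p x = (if x > 0 then poly p (1 / x) * exp (- 1 / x) else 0)"

text \<open>Away from \<open>0\<close> this is the chain rule: with \<open>y = 1/x\<close>, the derivative of \<open>p(y) exp(-y)\<close> is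
\<open>y\<^sup>2 (p(y) - p'(y)) exp(-y)\<close>. At \<open>0\<close> the difference quotient is again of the form
\<open>q(1/x) exp(-1/x)\<close>, and the exponential beats the polynomial.\<close>

lemma flat_exp_derivative:
  "(flat_exp p has_real_derivative flat_exp ([:0, 0, 1:] * (p - pderiv p)) x) (at x)"
proof (cases x "0 :: real" rule: linorder_cases)
  case less
  have "((\<lambda>x. 0) has_real_derivative 0) (at x)" by simp
  moreover have "\<forall>\<^sub>F y in nhds x. 0 = flat_exp p y"
    using eventually_nhds_in_open[of "{..<0}" x] less
    by (auto elim!: eventually_mono simp: flat_exp_def)
  ultimately have "(flat_exp p has_real_derivative 0) (at x)"
    by (subst DERIV_cong_ev[where f="flat_exp p" and g="\<lambda>x. 0" and v=0]) (auto elim: eventually_mono)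
  then show ?thesis using less by (simp add: flat_exp_def)
next
  case greater
  have "((\<lambda>x. poly p (1 / x) * exp (- 1 / x)) has_real_derivative flat_exp ([:0, 0, 1:] * (p - pderiv p)) x) (at x)"
    using greater
    by (auto intro!: derivative_eq_intros DERIV_chain2[OF poly_DERIV] simp: flat_exp_def field_simps power2_eq_square)
  moreover have "\<forall>\<^sub>F y in nhds x. flat_exp p y = poly p (1 / y) * exp (- 1 / y)"
    using eventually_nhds_in_open[of "{0<..}" x] greater
    by (auto elim!: eventually_mono simp: flat_exp_def)
  ultimately show ?thesis by (subst DERIV_cong_ev) auto
next
  case equal
  have "((\<lambda>h. flat_exp p h / h) \<longlongrightarrow> 0) (at_right 0)"
  proof (rule Lim_transform_eventually[OF poly_exp_neg_inverse_tendsto_0[of "[:0, 1:] * p"]])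
    show "\<forall>\<^sub>F x in at_right 0. poly ([:0, 1:] * p) (1 / x) * exp (- 1 / x) = flat_exp p x / x"
      using eventually_at_right_less[of 0]
      by (auto elim!: eventually_mono simp: flat_exp_def)
  qed
  moreover have "((\<lambda>h. flat_exp p h / h) \<longlongrightarrow> 0) (at_left 0)"
    by (rule Lim_transform_eventually[OF tendsto_const[of 0]])
       (auto simp: eventually_at_filter flat_exp_def)
  ultimately have "((\<lambda>h. flat_exp p h / h) \<longlongrightarrow> 0) (at 0)"
    by (simp add: filterlim_split_at)
  then show ?thesis using equal by (simp add: DERIV_def flat_exp_def)
qed

lemma flat_exp_smooth: "smooth (flat_exp p)"
  by (rule smooth_coinduct[where S = "range flat_exp"]) (use flat_exp_derivative in blast)+

text \<open>The step is the normalised primitive of the bump \<open>b(x) = exp(-1/(x(1-x)))\<close> on \<open>(0,1)\<close>. As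
\<open>x(1-x)\<close> is at most \<open>1/4\<close> everywhere and at least \<open>3/16\<close> on the middle half of the interval, the
bump is at most \<open>exp(-4)\<close> and has integral at least \<open>exp(-16/3)/2\<close>; the quotient is the explicit bound
on the derivative, on which the constant of the final upper bound depends.\<close>

lemma smooth_step_exists:
  "\<exists>S. smooth S \<and> (\<forall>x\<le>0. S x = 0) \<and> (\<forall>x\<ge>1. S x = 1) \<and> (\<forall>x. 0 \<le> S x \<and> S x \<le> 1)
     \<and> (\<forall>x. \<bar>deriv S x\<bar> \<le> 2 * exp (4 / 3)) \<and> (\<forall>x. x \<le> 0 \<or> 1 \<le> x \<longrightarrow> deriv S x = 0)"
proof -
  define b where "b x = flat_exp 1 x * flat_exp 1 (- 1 * x + 1)" for x
  have b_smooth: "smooth b"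
    unfolding b_def by (intro smooth_mult smooth_compose_affine flat_exp_smooth)
  have b_nonneg: "0 \<le> b x" for x by (simp add: b_def flat_exp_def)
  have b_out: "b x = 0" if "x \<le> 0 \<or> 1 \<le> x" for x using that by (auto simp: b_def flat_exp_def)
  have b_in: "b x = exp (- (1 / (x * (1 - x))))" if "0 < x" "x < 1" for x
    using that by (simp add: b_def flat_exp_def flip: exp_add) (simp add: field_simps)
  have b_le: "b x \<le> exp (- 4)" for x
  proof (cases "0 < x \<and> x < 1")
    case True
    have "0 \<le> (x - 1/2)\<^sup>2" by simp
    then have "4 * (x * (1 - x)) \<le> 1" by (simp add: power2_eq_square algebra_simps)
    then have "4 \<le> 1 / (x * (1 - x))" using True by (simp add: field_simps)
    then show ?thesis using True by (simp add: b_in)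
  qed (use b_out in \<open>auto simp: not_less\<close>)
  have b_ge: "exp (- (16 / 3)) \<le> b x" if "1/4 < x" "x < 3/4" for x
  proof -
    have "0 \<le> (x - 1/4) * (3/4 - x)" using that by simp
    then have "3 \<le> 16 * (x * (1 - x))" by (simp add: field_simps)
    then have "1 / (x * (1 - x)) \<le> 16 / 3" using that by (simp add: field_simps)
    then show ?thesis using that by (simp add: b_in)
  qed
  obtain F where "\<And>x. (F has_vector_derivative b x) (at x)"
  proof -
    have "isCont b x" for x
      using smooth_continuous[OF b_smooth, of UNIV] by (simp add: continuous_on_eq_continuous_at)
    then show ?thesis
      using einterval_antiderivative[of "-\<infinity>" "\<infinity>" b] that by auto
  qed
  then have F: "(F has_real_derivative b x) (at x)" for x
    by (simp add: has_real_derivative_iff_has_vector_derivative)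
  have mono: "F x \<le> F y" if "x \<le> y" for x y
    by (rule DERIV_nonneg_imp_nondecreasing[OF that]) (use F b_nonneg in blast)
  have F0: "F x = F 0" if "x \<le> 0" for x
  proof (cases "x = 0")
    case False
    then have "x < 0" using that by simp
    from MVT2[OF this F] obtain z where "z < 0" "F 0 - F x = (0 - x) * b z" by auto
    then show ?thesis using b_out[of z] by simp
  qed simp
  have F1: "F x = F 1" if "x \<ge> 1" for x
  proof (cases "x = 1")
    case False
    then have "1 < x" using that by simp
    from MVT2[OF this F] obtain z where "1 < z" "F x - F 1 = (x - 1) * b z" by auto
    then show ?thesis using b_out[of z] by simp
  qed simp
  define C where "C = F 1 - F 0"
  have C: "exp (- (16 / 3)) / 2 \<le> C"
  proof -
    have "1/4 < (3/4::real)" by simp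
    from MVT2[OF this F] obtain z where z: "1/4 < z" "z < 3/4" "F (3/4) - F (1/4) = (3/4 - 1/4) * b z" by auto
    moreover have "F 0 \<le> F (1/4)" "F (3/4) \<le> F 1" by (auto intro: mono)
    ultimately show ?thesis using b_ge[OF z(1,2)] by (simp add: C_def)
  qed
  then have C_pos: "0 < C" by (rule less_le_trans[rotated]) simp
  define S where "S x = (F x - F 0) / C" for x
  have S: "(S has_real_derivative 1 / C * b x) (at x)" for x
    unfolding S_def using F[of x] C_pos by (auto intro!: derivative_eq_intros)
  have dS: "smooth S" "deriv S = (\<lambda>x. 1 / C * b x)"
    by (rule smooth_of_derivative[OF S smooth_mult[OF smooth_const b_smooth]])+
  have "\<bar>deriv S x\<bar> \<le> 2 * exp (4 / 3)" for x
  proof -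
    have "b x \<le> exp (-4)" by (rule b_le)
    also have "\<dots> = 2 * exp (4/3) * (exp (- (16 / 3)) / 2)" by (simp flip: exp_add)
    also have "\<dots> \<le> 2 * exp (4/3) * C" using C by (intro mult_left_mono) auto
    finally have "1 / C * b x \<le> 2 * exp (4/3)" using C_pos by (simp add: field_simps)
    moreover have "0 \<le> 1 / C * b x" using C_pos b_nonneg[of x] by simp
    ultimately show ?thesis unfolding dS by (simp only: abs_of_nonneg)
  qed
  moreover have "0 \<le> S x \<and> S x \<le> 1" for x
    using mono[of x 0] mono[of 0 x] mono[of x 1] mono[of 1 x] F0[of x] F1[of x] C_pos
    by (cases "x \<le> 0"; cases "x \<ge> 1") (auto simp: S_def C_def field_simps)
  moreover have "S x = 1" if "x \<ge> 1" for x using F1[OF that] C_pos by (simp add: S_def C_def)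
  moreover have "S x = 0" if "x \<le> 0" for x using F0[OF that] by (simp add: S_def)
  moreover have "deriv S x = 0" if "x \<le> 0 \<or> 1 \<le> x" for x using b_out[OF that] by (simp add: dS)
  ultimately show ?thesis using dS(1) by (intro exI[of _ S] conjI allI impI) blast+
qed

definition smooth_step :: "real \<Rightarrow> real" where
  "smooth_step = (SOME S. smooth S \<and> (\<forall>x\<le>0. S x = 0) \<and> (\<forall>x\<ge>1. S x = 1) \<and> (\<forall>x. 0 \<le> S x \<and> S x \<le> 1)
     \<and> (\<forall>x. \<bar>deriv S x\<bar> \<le> 2 * exp (4 / 3)) \<and> (\<forall>x. x \<le> 0 \<or> 1 \<le> x \<longrightarrow> deriv S x = 0))"

lemma smooth_step:
  shows smooth_smooth_step: "smooth smooth_step"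
    and smooth_step_0: "x \<le> 0 \<Longrightarrow> smooth_step x = 0"
    and smooth_step_1: "x \<ge> 1 \<Longrightarrow> smooth_step x = 1"
    and smooth_step_nonneg: "0 \<le> smooth_step x"
    and smooth_step_le_1: "smooth_step x \<le> 1"
    and smooth_step_deriv_le: "\<bar>deriv smooth_step x\<bar> \<le> 2 * exp (4 / 3)"
    and smooth_step_deriv_0: "x \<le> 0 \<or> 1 \<le> x \<Longrightarrow> deriv smooth_step x = 0"
  using someI_ex[OF smooth_step_exists] unfolding smooth_step_def[symmetric] by blast+

definition cutoff :: "nat \<Rightarrow> real \<Rightarrow> real" where
  "cutoff n x = smooth_step (x + real n + 1) * smooth_step (real n + 1 - x)"

lemma smooth_cutoff: "smooth (cutoff n)"
  unfolding cutoff_def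
  using smooth_mult[OF smooth_compose_affine[OF smooth_smooth_step, of 1 "real n + 1"]
      smooth_compose_affine[OF smooth_smooth_step, of "-1" "real n + 1"]]
  by (simp add: algebra_simps)

lemma cutoff_derivative:
  "(cutoff n has_real_derivative
     deriv smooth_step (x + real n + 1) * smooth_step (real n + 1 - x)
     - smooth_step (x + real n + 1) * deriv smooth_step (real n + 1 - x)) (at x)"
proof -
  have "((\<lambda>x. x + real n + 1) has_real_derivative 1) (at x)"
    and "((\<lambda>x. real n + 1 - x) has_real_derivative - 1) (at x)"
    by (auto intro!: derivative_eq_intros)
  from DERIV_mult[OF DERIV_chain2[OF smoothD(1)[OF smooth_smooth_step] this(1)]
      DERIV_chain2[OF smoothD(1)[OF smooth_smooth_step] this(2)]]
  show ?thesis by (simp add: cutoff_def[abs_def] mult.commute)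
qed

lemma cutoff_bounds: "0 \<le> cutoff n x" "cutoff n x \<le> 1"
  by (auto simp: cutoff_def smooth_step_nonneg smooth_step_le_1 mult_le_one)

lemma cutoff_eq_1: "\<bar>x\<bar> \<le> real n \<Longrightarrow> cutoff n x = 1"
  by (simp add: cutoff_def smooth_step_1)

lemma cutoff_eq_0: "real n + 1 \<le> \<bar>x\<bar> \<Longrightarrow> cutoff n x = 0"
  by (cases "x \<ge> 0") (auto simp: cutoff_def smooth_step_0)

lemma deriv_cutoff_eq_0: "\<bar>x\<bar> \<le> real n \<Longrightarrow> deriv (cutoff n) x = 0"
  by (subst DERIV_imp_deriv[OF cutoff_derivative]) (auto simp: smooth_step_deriv_0 abs_le_iff)

lemma deriv_cutoff_le: "\<bar>deriv (cutoff n) x\<bar> \<le> 4 * exp (4 / 3)"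
proof -
  have *: "\<bar>deriv smooth_step y * smooth_step z\<bar> \<le> 2 * exp (4 / 3) * 1" for y z
    unfolding abs_mult
    using smooth_step_nonneg[of z] smooth_step_le_1[of z] by (intro mult_mono smooth_step_deriv_le) auto
  show ?thesis
    using *[of "x + real n + 1" "real n + 1 - x"] *[of "real n + 1 - x" "x + real n + 1"]
    by (subst DERIV_imp_deriv[OF cutoff_derivative]) (simp add: mult.commute)
qed

text \<open>Cutoffs turn an arbitrary smooth function into test functions that agree with it on larger and
larger intervals.\<close>

lemma cutoff_mult_test_function:
  assumes "smooth g"
  shows "(\<lambda>x. g x * cutoff n x) \<in> test_functions"
proof -
  have "{x. g x * cutoff n x \<noteq> 0} \<subseteq> {- (real n + 1)..real n + 1}"
    using cutoff_eq_0[of n] by (force simp: not_le abs_le_iff intro: less_imp_le ccontr)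
  then have "closure {x. g x * cutoff n x \<noteq> 0} \<subseteq> {- (real n + 1)..real n + 1}"
    by (intro closure_minimal) auto
  then have "compact (closure {x. g x * cutoff n x \<noteq> 0})"
    by (metis closed_closure compact_Icc bounded_subset compact_eq_bounded_closed)
  then show ?thesis
    by (simp add: test_functions_def smooth_mult assms smooth_cutoff)
qed

section \<open>Logarithmic Sobolev inequalities on an interval\<close>

text \<open>If \<open>P\<close> and \<open>Q\<close> are primitives of \<open>p\<close> and \<open>q\<close> that vanish at \<open>a\<close>, the map \<open>T = Q\<^sup>-\<^sup>1 \<circ> P\<close> pushes the
density \<open>p\<close> on \<open>[a,b]\<close> to the density \<open>q\<close>. Working on a compact interval makes \<open>T\<close> fix both end points,
so that no boundary term survives in the integration by parts below.\<close>

lemma monotone_transport_exists: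
  fixes p q :: "real \<Rightarrow> real"
  assumes "a < b" and p: "continuous_on UNIV p" "\<And>x. 0 < p x"
    and q: "continuous_on UNIV q" "\<And>x. 0 < q x"
    and mass: "integral {a..b} p = integral {a..b} q"
  obtains T where "T a = a" "T b = b" "continuous_on {a..b} T"
    "\<And>x. x \<in> {a<..<b} \<Longrightarrow> (T has_real_derivative p x / q (T x)) (at x)"
proof -
  have "\<exists>P. \<forall>x. (P has_real_derivative r x) (at x)" if "continuous_on UNIV r" for r :: "real \<Rightarrow> real"
    using einterval_antiderivative[of "-\<infinity>" "\<infinity>" r] that
    by (simp add: continuous_on_eq_continuous_at has_real_derivative_iff_has_vector_derivative)
  then obtain P Q where P: "\<And>x. (P has_real_derivative p x) (at x)"
      and Q: "\<And>x. (Q has_real_derivative q x) (at x)"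
    using p(1) q(1) by metis
  have ftc: "(r has_integral R b - R a) {a..b}" if "\<And>x. (R has_real_derivative r x) (at x)" for r R :: "real \<Rightarrow> real"
    using \<open>a < b\<close> that
    by (intro fundamental_theorem_of_calculus)
       (auto simp: has_real_derivative_iff_has_vector_derivative[symmetric] intro: has_field_derivative_at_within)
  have mass': "P b - P a = Q b - Q a"
    using mass ftc[OF P] ftc[OF Q] by (simp add: integral_unique)
  have P_mono: "P x < P y" if "x < y" for x y
    by (rule DERIV_pos_imp_increasing[OF that]) (use P p in blast)
  have Q_mono: "Q x < Q y" if "x < y" for x y
    by (rule DERIV_pos_imp_increasing[OF that]) (use Q q in blast)
  have Q_inj: "inj_on Q {a..b}" by (rule inj_onI) (metis Q_mono less_irrefl linorder_neqE)
  have P_cont: "continuous_on A P" for A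
    using P by (meson DERIV_continuous_on has_field_derivative_at_within)
  have Q_cont: "continuous_on A Q" for A
    using Q by (meson DERIV_continuous_on has_field_derivative_at_within)
  have Q_le: "Q x \<le> Q y \<longleftrightarrow> x \<le> y" for x y
    by (metis Q_mono linorder_not_le less_le order.asym)
  have Q_image: "Q ` {a..b} = {Q a..Q b}"
  proof
    show "{Q a..Q b} \<subseteq> Q ` {a..b}"
      using IVT'[of Q a _ b, OF _ _ _ Q_cont] \<open>a < b\<close> by (auto simp: image_iff) (metis atLeastAtMost_iff)
  qed (auto simp: Q_le)
  define G where "G = inv_into {a..b} Q"
  have QG: "Q (G y) = y" if "y \<in> {Q a..Q b}" for y
    unfolding G_def by (rule f_inv_into_f) (use that Q_image in auto)
  have GQ: "G (Q x) = x" if "x \<in> {a..b}" for x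
    unfolding G_def by (rule inv_into_f_f[OF Q_inj that])
  have G_cont: "continuous_on {Q a..Q b} G"
    using continuous_on_inv[OF Q_cont, of "{a..b}" G] GQ Q_image by auto
  define T where "T x = G (P x - P a + Q a)" for x
  have in_range: "P x - P a + Q a \<in> {Q a..Q b}" if "x \<in> {a..b}" for x
    using that mass' P_mono[of a x] P_mono[of x b] by (cases "x = a"; cases "x = b") auto
  show thesis
  proof
    show "T a = a" using \<open>a < b\<close> by (simp add: T_def GQ)
    have "P b - P a + Q a = Q b" using mass' by simp
    then show "T b = b" using \<open>a < b\<close> by (simp add: T_def GQ)
    show "continuous_on {a..b} T"
      unfolding T_def
      by (rule continuous_on_compose2[OF G_cont]) (use in_range in \<open>auto intro!: continuous_intros P_cont\<close>)
    fix x assume x: "x \<in> {a<..<b}"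
    let ?y = "P x - P a + Q a"
    have y: "Q a < ?y" "?y < Q b"
      using x mass' P_mono[of a x] P_mono[of x b] by auto
    have "isCont G ?y"
      using G_cont y by (auto intro!: continuous_on_interior)
    then have "(G has_real_derivative inverse (q (T x))) (at ?y)"
      using y q(2)[of "T x"] Q[of "T x"]
      by (intro DERIV_inverse_function[where f = Q and a = "Q a" and b = "Q b"]) (auto simp: T_def QG)
    moreover have "((\<lambda>x. P x - P a + Q a) has_real_derivative p x) (at x)"
      using P[of x] by (auto intro!: derivative_eq_intros)
    ultimately have "((\<lambda>x. G (P x - P a + Q a)) has_real_derivative inverse (q (T x)) * p x) (at x)"
      by (rule DERIV_chain2)
    then show "(T has_real_derivative p x / q (T x)) (at x)"
      unfolding T_def by (simp add: field_simps)
  qed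
qed

lemma continuous_on_of_derivative:
  fixes f :: "real \<Rightarrow> real"
  assumes "\<And>x. (f has_real_derivative f' x) (at x)"
  shows "continuous_on A f"
  using assms by (meson DERIV_continuous_on has_field_derivative_at_within)

text \<open>The Bakry--Emery logarithmic Sobolev inequality, by optimal transport. Let \<open>T\<close> transport
\<open>\<rho> exp(-V)\<close> to \<open>exp(-V)\<close> and put \<open>\<theta> = T - id\<close>. Taking logarithms in
\<open>\<rho> exp(-V) = exp(-V \<circ> T) T'\<close>, and using \<open>ln(1 + \<theta>') \<le> \<theta>'\<close> and the convexity of \<open>V\<close>,
one gets \<open>ln \<rho> \<le> \<theta>' - V' \<theta> - K \<theta>\<^sup>2/2\<close>. Multiplied by
\<open>\<rho> exp(-V)\<close>, the first two terms are \<open>(\<rho> exp(-V) \<theta>)' - \<rho>' exp(-V) \<theta>\<close>; the total derivative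
integrates to \<open>0\<close>, and completing the square in \<open>\<theta>\<close> leaves \<open>\<rho>'\<^sup>2/(2K\<rho>)\<close>.\<close>

lemma transport_entropy_bound:
  fixes V V' \<rho> \<rho>' :: "real \<Rightarrow> real"
  assumes "a < b" "0 < K"
    and V: "\<And>x. (V has_real_derivative V' x) (at x)"
    and V_convex: "\<And>x y. V x + V' x * (y - x) + K / 2 * (y - x)\<^sup>2 \<le> V y"
    and V'_cont: "continuous_on UNIV V'"
    and \<rho>: "\<And>x. (\<rho> has_real_derivative \<rho>' x) (at x)" "\<And>x. 0 < \<rho> x"
    and \<rho>'_cont: "continuous_on UNIV \<rho>'"
    and mass: "integral {a..b} (\<lambda>x. \<rho> x * exp (- V x)) = integral {a..b} (\<lambda>x. exp (- V x))"
  shows "integral {a..b} (\<lambda>x. \<rho> x * ln (\<rho> x) * exp (- V x))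
    \<le> integral {a..b} (\<lambda>x. (\<rho>' x)\<^sup>2 / \<rho> x * exp (- V x)) / (2 * K)"
proof -
  have V_cont: "continuous_on A V" and \<rho>_cont: "continuous_on A \<rho>" for A
    using continuous_on_of_derivative[OF V] continuous_on_of_derivative[OF \<rho>(1)] by auto
  have V'_cont': "continuous_on A V'" and \<rho>'_cont': "continuous_on A \<rho>'" for A
    using V'_cont \<rho>'_cont by (auto intro: continuous_on_subset)
  obtain T where T: "T a = a" "T b = b" "continuous_on {a..b} T"
    and T': "\<And>x. x \<in> {a<..<b} \<Longrightarrow> (T has_real_derivative \<rho> x * exp (- V x) / exp (- V (T x))) (at x)"
  proof -
    have "continuous_on UNIV (\<lambda>x. \<rho> x * exp (- V x))" "continuous_on UNIV (\<lambda>x. exp (- V x))"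
      by (intro continuous_intros V_cont \<rho>_cont)+
    moreover have "0 < \<rho> x * exp (- V x)" "0 < exp (- V x)" for x using \<rho>(2) by auto
    ultimately show ?thesis
      using monotone_transport_exists[OF \<open>a < b\<close> _ _ _ _ mass] that by blast
  qed
  define \<theta> where "\<theta> x = T x - x" for x
  define \<theta>' where "\<theta>' x = \<rho> x * exp (- V x) / exp (- V (T x)) - 1" for x
  have \<theta>: "(\<theta> has_real_derivative \<theta>' x) (at x)" if "x \<in> {a<..<b}" for x
    unfolding \<theta>_def \<theta>'_def using T'[OF that] by (auto intro!: derivative_eq_intros)
  have \<theta>_cont: "continuous_on {a..b} \<theta>"
    unfolding \<theta>_def using T(3) by (auto intro!: continuous_intros)
  \<comment> \<open>The total derivative: \<open>H\<close> vanishes at both ends because \<open>T\<close> fixes them.\<close>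
  define H where "H x = \<rho> x * exp (- V x) * \<theta> x" for x
  define H' where "H' x = (\<rho>' x - \<rho> x * V' x) * exp (- V x) * \<theta> x + \<rho> x * exp (- V x) * \<theta>' x" for x
  have "(H' has_integral H b - H a) {a..b}"
  proof (rule fundamental_theorem_of_calculus_interior)
    show "continuous_on {a..b} H"
      unfolding H_def by (intro continuous_intros V_cont \<rho>_cont \<theta>_cont)
    fix x assume x: "x \<in> {a<..<b}"
    show "(H has_vector_derivative H' x) (at x)"
      unfolding has_real_derivative_iff_has_vector_derivative[symmetric] H_def H'_def
      using \<theta>[OF x] V[of x] \<rho>(1)[of x] by (auto intro!: derivative_eq_intros simp: algebra_simps)
  qed (use \<open>a < b\<close> in simp)
  moreover have "H a = 0" "H b = 0" by (simp_all add: H_def \<theta>_def T)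
  ultimately have H': "(H' has_integral 0) {a..b}" by simp
  have fisher: "(\<lambda>x. (\<rho>' x)\<^sup>2 / \<rho> x * exp (- V x)) integrable_on {a..b}"
    and ent: "(\<lambda>x. \<rho> x * ln (\<rho> x) * exp (- V x)) integrable_on {a..b}"
    using \<rho>(2) by (auto intro!: integrable_continuous_interval continuous_intros V_cont \<rho>_cont \<rho>'_cont' simp: less_imp_neq[symmetric])
  have pointwise: "\<rho> x * ln (\<rho> x) * exp (- V x) \<le> H' x + (\<rho>' x)\<^sup>2 / \<rho> x * exp (- V x) / (2 * K)" for x
  proof -
    have r: "0 < \<rho> x" by (rule \<rho>(2))
    have "ln (\<rho> x) - V x + V (T x) = ln (\<theta>' x + 1)"
      using r by (simp add: \<theta>'_def ln_mult ln_div)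
    also have "\<dots> \<le> \<theta>' x"
      using r ln_le_minus_one[of "\<theta>' x + 1"] by (simp add: \<theta>'_def)
    finally have "ln (\<rho> x) \<le> \<theta>' x - V' x * \<theta> x - K / 2 * (\<theta> x)\<^sup>2"
      using V_convex[of x "T x"] by (simp add: \<theta>_def)
    then have "\<rho> x * ln (\<rho> x) \<le> \<rho> x * (\<theta>' x - V' x * \<theta> x - K / 2 * (\<theta> x)\<^sup>2)"
      using r by simp
    also have "\<dots> \<le> (\<rho>' x - \<rho> x * V' x) * \<theta> x + \<rho> x * \<theta>' x + (\<rho>' x)\<^sup>2 / \<rho> x / (2 * K)"
    proof -
      have "0 \<le> (\<rho>' x + K * \<rho> x * \<theta> x)\<^sup>2 / (2 * K * \<rho> x)" using r \<open>0 < K\<close> by simp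
      also have "\<dots> = (\<rho>' x)\<^sup>2 / \<rho> x / (2 * K) + \<rho>' x * \<theta> x + \<rho> x * (K / 2 * (\<theta> x)\<^sup>2)"
        using r \<open>0 < K\<close> by (simp add: field_simps power2_eq_square)
      finally show ?thesis by (simp add: algebra_simps)
    qed
    finally have "\<rho> x * ln (\<rho> x) * exp (- V x)
      \<le> ((\<rho>' x - \<rho> x * V' x) * \<theta> x + \<rho> x * \<theta>' x + (\<rho>' x)\<^sup>2 / \<rho> x / (2 * K)) * exp (- V x)"
      by (intro mult_right_mono) auto
    then show ?thesis by (simp add: H'_def algebra_simps)
  qed
  have "((\<lambda>x. H' x + (\<rho>' x)\<^sup>2 / \<rho> x * exp (- V x) / (2 * K)) has_integral
      0 + integral {a..b} (\<lambda>x. (\<rho>' x)\<^sup>2 / \<rho> x * exp (- V x)) / (2 * K)) {a..b}"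
    by (intro has_integral_add H' has_integral_divide integrable_integral fisher)
  from has_integral_le[OF integrable_integral[OF ent] this pointwise] show ?thesis by simp
qed

text \<open>The entropy of \<open>g\<close> for the unnormalised weight \<open>w\<close>: the partition function times the entropy with
respect to the probability measure proportional to \<open>w\<close> on \<open>[a,b]\<close>. In this form the length of the
interval enters only through the logarithm once \<open>g\<close> vanishes near its ends.\<close>

definition interval_entropy :: "real \<Rightarrow> real \<Rightarrow> (real \<Rightarrow> real) \<Rightarrow> (real \<Rightarrow> real) \<Rightarrow> real" where
  "interval_entropy a b w g = integral {a..b} (\<lambda>x. g x * ln (g x) * w x)
     - integral {a..b} (\<lambda>x. g x * w x) * ln (integral {a..b} (\<lambda>x. g x * w x) / integral {a..b} w)"

lemma integral_pos_of_continuous: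
  fixes f :: "real \<Rightarrow> real"
  assumes "a < b" "continuous_on {a..b} f" "\<And>x. 0 < f x"
  shows "0 < integral {a..b} f"
proof -
  obtain m where m: "m \<in> {a..b}" "\<And>x. x \<in> {a..b} \<Longrightarrow> f m \<le> f x"
    using continuous_attains_inf[of "{a..b}" f] assms by auto
  have "0 < f m * (b - a)" using assms by simp
  also have "\<dots> = integral {a..b} (\<lambda>x. f m)" using assms by simp
  also have "\<dots> \<le> integral {a..b} f"
    using m assms by (intro integral_le) (auto intro: integrable_continuous_interval)
  finally show ?thesis .
qed

text \<open>Both sides are homogeneous of degree one in \<open>g\<close>, so the transport inequality for the normalised
density \<open>g/c\<close> suffices.\<close>

lemma interval_log_sobolev_convex:
  fixes V V' g g' :: "real \<Rightarrow> real"
  assumes "a < b" "0 < K"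
    and V: "\<And>x. (V has_real_derivative V' x) (at x)"
    and V_convex: "\<And>x y. V x + V' x * (y - x) + K / 2 * (y - x)\<^sup>2 \<le> V y"
    and V'_cont: "continuous_on UNIV V'"
    and g: "\<And>x. (g has_real_derivative g' x) (at x)" "\<And>x. 0 < g x"
    and g'_cont: "continuous_on UNIV g'"
  shows "interval_entropy a b (\<lambda>x. exp (- V x)) g
    \<le> integral {a..b} (\<lambda>x. (g' x)\<^sup>2 / g x * exp (- V x)) / (2 * K)"
proof -
  have V_cont: "continuous_on A V" and g_cont: "continuous_on A g" for A
    using continuous_on_of_derivative[OF V] continuous_on_of_derivative[OF g(1)] by auto
  define A where "A = integral {a..b} (\<lambda>x. g x * exp (- V x))"
  define Z where "Z = integral {a..b} (\<lambda>x. exp (- V x))"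
  have A: "0 < A" and Z: "0 < Z"
    unfolding A_def Z_def using \<open>a < b\<close> g(2)
    by (auto intro!: integral_pos_of_continuous continuous_intros V_cont g_cont)
  define c where "c = A / Z"
  have c: "0 < c" using A Z by (simp add: c_def)
  have int: "(\<lambda>x. g x * ln (g x) * exp (- V x)) integrable_on {a..b}" "(\<lambda>x. g x * exp (- V x)) integrable_on {a..b}"
    using g(2) by (auto intro!: integrable_continuous_interval continuous_intros V_cont g_cont simp: less_imp_neq[symmetric])
  have "integral {a..b} (\<lambda>x. g x / c * ln (g x / c) * exp (- V x))
    \<le> integral {a..b} (\<lambda>x. (g' x / c)\<^sup>2 / (g x / c) * exp (- V x)) / (2 * K)"
  proof (rule transport_entropy_bound[OF \<open>a < b\<close> \<open>0 < K\<close> V V_convex V'_cont])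
    show "((\<lambda>x. g x / c) has_real_derivative g' x / c) (at x)" for x
      using g(1)[of x] c by (auto intro!: derivative_eq_intros)
    show "continuous_on UNIV (\<lambda>x. g' x / c)" using c by (auto intro!: continuous_intros g'_cont)
    have "integral {a..b} (\<lambda>x. g x / c * exp (- V x)) = A / c" by (simp add: A_def)
    then show "integral {a..b} (\<lambda>x. g x / c * exp (- V x)) = integral {a..b} (\<lambda>x. exp (- V x))"
      using A Z by (simp add: c_def Z_def)
  qed (use g(2) c in auto)
  also have "integral {a..b} (\<lambda>x. (g' x / c)\<^sup>2 / (g x / c) * exp (- V x))
      = integral {a..b} (\<lambda>x. (g' x)\<^sup>2 / g x * exp (- V x)) / c"
    using c by (simp add: power2_eq_square mult.commute flip: integral_divide)
  also have "(\<lambda>x. g x / c * ln (g x / c) * exp (- V x))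
      = (\<lambda>x. (g x * ln (g x) * exp (- V x) - ln c * (g x * exp (- V x))) / c)"
    using c g(2) by (auto simp: fun_eq_iff ln_div field_simps)
  also have "integral {a..b} (\<lambda>x. (g x * ln (g x) * exp (- V x) - ln c * (g x * exp (- V x))) / c)
     = interval_entropy a b (\<lambda>x. exp (- V x)) g / c"
    using int
    by (simp only: integral_divide integral_diff integrable_on_mult_right integral_mult_right
        interval_entropy_def A_def[symmetric] Z_def[symmetric] c_def[symmetric] mult.commute)
  finally show ?thesis using c \<open>0 < K\<close> by (simp add: divide_simps split: if_splits)
qed

text \<open>The Holley--Stroock perturbation argument. The entropy is the minimum over \<open>t > 0\<close> of the integral
of \<open>\<phi>\<^sub>t(g) = g ln g - g ln t - g + t\<close>, attained where \<open>t\<close> is the mean of \<open>g\<close>. Since \<open>\<phi>\<^sub>t\<close> is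
nonnegative, its integral is monotone in the weight.\<close>

lemma interval_entropy_le_perturbed:
  fixes w v g :: "real \<Rightarrow> real"
  assumes "a < b" and w: "continuous_on UNIV w" "\<And>x. 0 < w x" and v: "continuous_on UNIV v" "\<And>x. 0 < v x"
    and g: "continuous_on UNIV g" "\<And>x. 0 < g x" and le: "\<And>x. w x \<le> v x"
  shows "interval_entropy a b w g \<le> interval_entropy a b v g"
proof -
  have cont: "continuous_on A w" "continuous_on A v" "continuous_on A g" for A
    using w v g by (auto intro: continuous_on_subset)
  have g_nz: "g x \<noteq> 0" for x using g(2)[of x] by simp
  define A where "A r = integral {a..b} (\<lambda>x. g x * r x)" for r :: "real \<Rightarrow> real"
  define Z where "Z r = integral {a..b} r" for r :: "real \<Rightarrow> real"
  have pos: "0 < A w" "0 < Z w" "0 < A v" "0 < Z v"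
    unfolding A_def Z_def using \<open>a < b\<close> w(2) v(2) g(2)
    by (auto intro!: integral_pos_of_continuous continuous_intros cont)
  define t where "t = A v / Z v"
  have t: "0 < t" using pos by (simp add: t_def)
  define \<phi> where "\<phi> x = g x * ln (g x) - ln t * g x - g x + t" for x
  have \<phi>_nonneg: "0 \<le> \<phi> x" for x
  proof -
    have "g x * (1 - t / g x) \<le> g x * ln (g x / t)"
      using ln_le_minus_one[of "t / g x"] t g(2)[of x] by (intro mult_left_mono) (auto simp: ln_div)
    then show ?thesis using g(2)[of x] t by (simp add: \<phi>_def ln_div algebra_simps)
  qed
  have \<phi>_int: "integral {a..b} (\<lambda>x. \<phi> x * r x)
      = integral {a..b} (\<lambda>x. g x * ln (g x) * r x) - ln t * A r - A r + t * Z r"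
    if "continuous_on {a..b} r" for r
  proof -
    have i: "(\<lambda>x. g x * ln (g x) * r x) integrable_on {a..b}" "(\<lambda>x. g x * r x) integrable_on {a..b}" "r integrable_on {a..b}"
      using that by (auto intro!: integrable_continuous_interval continuous_intros cont simp: g_nz)
    have "((\<lambda>x. g x * ln (g x) * r x - ln t * (g x * r x) - g x * r x + t * r x) has_integral
       integral {a..b} (\<lambda>x. g x * ln (g x) * r x) - ln t * A r - A r + t * Z r) {a..b}"
      unfolding A_def Z_def
      by (intro has_integral_add has_integral_diff has_integral_mult_right integrable_integral i)
    moreover have "(\<lambda>x. g x * ln (g x) * r x - ln t * (g x * r x) - g x * r x + t * r x) = (\<lambda>x. \<phi> x * r x)"
      by (auto simp: \<phi>_def algebra_simps)
    ultimately show ?thesis by (simp add: integral_unique)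
  qed
  have "interval_entropy a b w g \<le> integral {a..b} (\<lambda>x. \<phi> x * w x)"
  proof -
    have "A w * (1 - t * Z w / A w) \<le> A w * ln (A w / (t * Z w))"
      using ln_le_minus_one[of "t * Z w / A w"] t pos by (intro mult_left_mono) (auto simp: ln_div)
    also have "ln (A w / (t * Z w)) = ln (A w / Z w) - ln t"
      using pos t by (simp add: ln_div ln_mult)
    finally have "A w - t * Z w \<le> A w * ln (A w / Z w) - ln t * A w"
      using pos by (simp add: algebra_simps)
    then show ?thesis
      by (simp add: \<phi>_int[OF cont(1)] interval_entropy_def A_def[symmetric] Z_def[symmetric])
  qed
  also have "\<dots> \<le> integral {a..b} (\<lambda>x. \<phi> x * v x)"
    using \<phi>_nonneg le
    by (intro integral_le mult_left_mono integrable_continuous_interval)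
       (auto simp: \<phi>_def g_nz intro!: continuous_intros cont)
  also have "\<dots> = interval_entropy a b v g"
    using pos by (simp add: \<phi>_int[OF cont(2)] interval_entropy_def A_def[symmetric] Z_def[symmetric] t_def mult.commute)
  finally show ?thesis .
qed

lemma continuous_on_x_ln_x: "continuous_on {0..} (\<lambda>s::real. s * ln s)"
  unfolding continuous_on_def
proof
  fix x :: real assume x: "x \<in> {0..}"
  show "((\<lambda>s. s * ln s) \<longlongrightarrow> x * ln x) (at x within {0..})"
  proof (cases "x = 0")
    case True
    have "((\<lambda>s::real. s * ln s) \<longlongrightarrow> 0) (at_right 0)" by real_asymp
    then show ?thesis using True by (simp add: at_within_Ici_at_right)
  next
    case False
    then show ?thesis using x by (intro tendsto_intros) auto
  qed
qed

lemma x_ln_x_superadditive: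
  fixes s e :: real
  assumes "0 \<le> s" "0 < e"
  shows "s * ln s + e * ln e \<le> (s + e) * ln (s + e)"
proof (cases "s = 0")
  case False
  then have "s * ln s \<le> s * ln (s + e)" "e * ln e \<le> e * ln (s + e)"
    using assms by (auto intro!: mult_left_mono)
  then show ?thesis by (simp add: algebra_simps)
qed simp

text \<open>The convex case and the perturbation argument, applied to the strictly positive function \<open>f\<^sup>2 + e\<close>, whose Fisher information
density \<open>4 f\<^sup>2 f'\<^sup>2/(f\<^sup>2 + e)\<close> is at most \<open>4 f'\<^sup>2\<close>. The entropy is compared with that of \<open>f\<^sup>2\<close> through
superadditivity of \<open>s ln s\<close>, and \<open>e\<close> tends to \<open>0\<close>. Comparing the energy for the weight \<open>exp(-V)\<close>
with the one for \<open>exp(-V-h)\<close> costs the factor \<open>exp M\<close>.\<close>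

lemma interval_log_sobolev_perturbed:
  fixes V V' h f f' :: "real \<Rightarrow> real"
  assumes "a < b" "0 < K"
    and V: "\<And>x. (V has_real_derivative V' x) (at x)"
    and V_convex: "\<And>x y. V x + V' x * (y - x) + K / 2 * (y - x)\<^sup>2 \<le> V y"
    and V'_cont: "continuous_on UNIV V'"
    and h: "continuous_on UNIV h" "\<And>x. 0 \<le> h x" "\<And>x. h x \<le> M"
    and f: "\<And>x. (f has_real_derivative f' x) (at x)"
    and f'_cont: "continuous_on UNIV f'"
  shows "interval_entropy a b (\<lambda>x. exp (- (V x + h x))) (\<lambda>x. (f x)\<^sup>2)
    \<le> 2 * exp M / K * integral {a..b} (\<lambda>x. (f' x)\<^sup>2 * exp (- (V x + h x)))"
proof -
  define w where "w x = exp (- (V x + h x))" for x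
  have V_cont: "continuous_on A V" and f_cont: "continuous_on A f" and f'_cont': "continuous_on A f'"
      and h_cont: "continuous_on A h" for A
    using continuous_on_of_derivative[OF V] continuous_on_of_derivative[OF f] f'_cont h(1)
    by (auto intro: continuous_on_subset)
  have w_cont: "continuous_on A w" for A
    unfolding w_def by (intro continuous_intros V_cont h_cont)
  define A where "A = integral {a..b} (\<lambda>x. (f x)\<^sup>2 * w x)"
  define Z where "Z = integral {a..b} w"
  define D where "D = integral {a..b} (\<lambda>x. (f' x)\<^sup>2 * w x)"
  define L where "L = integral {a..b} (\<lambda>x. (f x)\<^sup>2 * ln ((f x)\<^sup>2) * w x)"
  have Z: "0 < Z"
    unfolding Z_def by (rule integral_pos_of_continuous[OF \<open>a < b\<close> w_cont]) (simp add: w_def)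
  have "0 \<le> A"
    unfolding A_def by (intro integral_nonneg integrable_continuous_interval continuous_intros f_cont w_cont) (simp add: w_def)
  have L_cont: "continuous_on {a..b} (\<lambda>x. (f x)\<^sup>2 * ln ((f x)\<^sup>2))"
    by (rule continuous_on_compose2[OF continuous_on_x_ln_x]) (auto intro!: continuous_intros f_cont)
  have main: "L + Z * (e * ln e) - (A + e * Z) * ln ((A + e * Z) / Z) \<le> 2 * exp M / K * D" if "0 < e" for e
  proof -
    define g where "g x = (f x)\<^sup>2 + e" for x
    define g' where "g' x = 2 * f x * f' x" for x
    have g_pos: "0 < g x" for x using that by (simp add: g_def add_nonneg_pos)
    have g_nz: "(f x)\<^sup>2 + e \<noteq> 0" for x using g_pos[of x] by (simp add: g_def)
    have g_deriv: "(g has_real_derivative g' x) (at x)" for x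
      unfolding g_def g'_def using f[of x] by (auto intro!: derivative_eq_intros)
    have g_cont: "continuous_on B g" for B unfolding g_def by (intro continuous_intros f_cont)
    have g'_cont: "continuous_on B g'" for B unfolding g'_def by (intro continuous_intros f_cont f'_cont')
    have i: "(\<lambda>x. (f x)\<^sup>2 * ln ((f x)\<^sup>2) * w x) integrable_on {a..b}" "w integrable_on {a..b}"
        "(\<lambda>x. (f x)\<^sup>2 * w x) integrable_on {a..b}" "(\<lambda>x. g x * ln (g x) * w x) integrable_on {a..b}"
      by (auto intro!: integrable_continuous_interval continuous_intros L_cont w_cont f_cont simp: g_def g_nz)
    have gA: "integral {a..b} (\<lambda>x. g x * w x) = A + e * Z"
      using i unfolding g_def distrib_right A_def Z_def
      by (subst integral_add) (auto intro: integrable_on_mult_right)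
    have "L + Z * (e * ln e) = integral {a..b} (\<lambda>x. (f x)\<^sup>2 * ln ((f x)\<^sup>2) * w x + (e * ln e) * w x)"
      unfolding L_def Z_def by (subst integral_add) (auto intro: i integrable_on_mult_right)
    also have "\<dots> \<le> integral {a..b} (\<lambda>x. g x * ln (g x) * w x)"
    proof (rule integral_le)
      fix x
      have "((f x)\<^sup>2 * ln ((f x)\<^sup>2) + e * ln e) * w x \<le> (g x * ln (g x)) * w x"
        unfolding g_def using that by (intro mult_right_mono x_ln_x_superadditive) (auto simp: w_def)
      then show "(f x)\<^sup>2 * ln ((f x)\<^sup>2) * w x + (e * ln e) * w x \<le> g x * ln (g x) * w x"
        by (simp add: algebra_simps)
    qed (intro integrable_add integrable_on_mult_right i)+
    finally have "L + Z * (e * ln e) - (A + e * Z) * ln ((A + e * Z) / Z) \<le> interval_entropy a b w g"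
      by (simp add: interval_entropy_def gA Z_def[symmetric])
    also have "\<dots> \<le> interval_entropy a b (\<lambda>x. exp (- V x)) g"
      by (rule interval_entropy_le_perturbed[OF \<open>a < b\<close>])
         (use h in \<open>auto simp: w_def intro!: continuous_intros V_cont h_cont g_cont g_pos\<close>)
    also have "\<dots> \<le> integral {a..b} (\<lambda>x. (g' x)\<^sup>2 / g x * exp (- V x)) / (2 * K)"
      by (rule interval_log_sobolev_convex[OF \<open>a < b\<close> \<open>0 < K\<close> V V_convex V'_cont g_deriv g_pos g'_cont])
    also have "\<dots> \<le> integral {a..b} (\<lambda>x. 4 * exp M * ((f' x)\<^sup>2 * w x)) / (2 * K)"
    proof (intro divide_right_mono integral_le)
      fix x
      have "(g' x)\<^sup>2 / g x \<le> 4 * (f' x)\<^sup>2"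
      proof -
        have "(g' x)\<^sup>2 = 4 * (f' x)\<^sup>2 * (f x)\<^sup>2" by (simp add: g'_def power_mult_distrib)
        also have "\<dots> \<le> 4 * (f' x)\<^sup>2 * g x" using that by (intro mult_left_mono) (auto simp: g_def)
        finally show ?thesis using g_pos[of x] by (simp add: field_simps)
      qed
      moreover have "exp (- V x) \<le> exp M * w x"
        using h(3)[of x] by (simp add: w_def flip: exp_add)
      ultimately have "(g' x)\<^sup>2 / g x * exp (- V x) \<le> 4 * (f' x)\<^sup>2 * (exp M * w x)"
        by (intro mult_mono) auto
      then show "(g' x)\<^sup>2 / g x * exp (- V x) \<le> 4 * exp M * ((f' x)\<^sup>2 * w x)" by (simp add: mult_ac)
    qed (use \<open>0 < K\<close> in \<open>auto simp: g_def g_nz intro!: integrable_continuous_interval continuous_intros V_cont f_cont g'_cont f'_cont' w_cont\<close>)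
    also have "\<dots> = 2 * exp M / K * D" by (simp add: D_def)
    finally show ?thesis .
  qed
  have "((\<lambda>e. L + Z * (e * ln e) - (A + e * Z) * ln ((A + e * Z) / Z)) \<longlongrightarrow> L + Z * 0 - A * ln (A / Z)) (at_right 0)"
  proof (intro tendsto_diff tendsto_add tendsto_const tendsto_mult_left)
    show "((\<lambda>e::real. e * ln e) \<longlongrightarrow> 0) (at_right 0)" by real_asymp
    show "((\<lambda>e. (A + e * Z) * ln ((A + e * Z) / Z)) \<longlongrightarrow> A * ln (A / Z)) (at_right 0)"
    proof (cases "A = 0")
      \<comment> \<open>Here \<open>ln\<close> is evaluated near its singularity, but with the factor \<open>e\<close> in front.\<close>
      case True
      have "((\<lambda>e. Z * (e * ln e)) \<longlongrightarrow> Z * 0) (at_right 0)" 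
        by (intro tendsto_intros) real_asymp
      then show ?thesis using True Z by (simp add: mult_ac)
    next
      case False
      then have "((\<lambda>e. (A + e * Z) * ln ((A + e * Z) / Z)) \<longlongrightarrow> (A + 0 * Z) * ln ((A + 0 * Z) / Z)) (at_right 0)"
        using Z \<open>0 \<le> A\<close> by (intro tendsto_intros) auto
      then show ?thesis by simp
    qed
  qed
  then have "L + Z * 0 - A * ln (A / Z) \<le> 2 * exp M / K * D"
    by (rule tendsto_upperbound[OF _ eventually_mono[OF eventually_at_right_less main]])
       (assumption | rule trivial_limit_at_right_real)+
  then show ?thesis
    by (simp add: interval_entropy_def L_def A_def Z_def D_def w_def[abs_def])
qed

section \<open>Gibbs measures on the line\<close>

lemma integral_Icc:
  fixes f :: "real \<Rightarrow> real"
  assumes "continuous_on {a..b} f"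
  shows "integral {a..b} f = (LINT x|lborel. indicator {a..b} x * f x)"
  using set_borel_integral_eq_integral(2)[OF borel_integrable_atLeastAtMost'[OF assms]]
  by (simp add: set_lebesgue_integral_def)

lemma integral_Icc_eq_LINT:
  fixes f :: "real \<Rightarrow> real"
  assumes "continuous_on UNIV f" "\<And>x. x \<notin> {a..b} \<Longrightarrow> f x = 0"
  shows "integral {a..b} f = (LINT x|lborel. f x)"
proof -
  have "(\<lambda>x. indicator {a..b} x * f x) = f"
    using assms(2) by (auto simp: fun_eq_iff indicator_def)
  then show ?thesis using integral_Icc[of a b f, OF continuous_on_subset[OF assms(1)]] by simp
qed

locale gibbs_potential =
  fixes u :: "real \<Rightarrow> real"
  assumes u_cont: "continuous_on UNIV u"
    and weight_integrable: "integrable lborel (\<lambda>x. exp (- u x))"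
begin

lemma u_cont_on: "continuous_on A u"
  using u_cont by (rule continuous_on_subset) simp

lemma weight_cont: "continuous_on A (\<lambda>x. exp (- u x))"
  by (intro continuous_intros u_cont_on)

lemma u_borel [measurable]: "u \<in> borel_measurable borel"
  by (rule borel_measurable_continuous_onI[OF u_cont])

lemma weight_integral_tendsto:
  "(\<lambda>n. integral {- real n..real n} (\<lambda>x. exp (- u x))) \<longlonglongrightarrow> partition_function u"
proof -
  have "(\<lambda>n. LINT x|lborel. indicator {- real n..real n} x * exp (- u x)) \<longlonglongrightarrow> (LINT x|lborel. exp (- u x))"
  proof (rule integral_dominated_convergence[OF _ _ weight_integrable])
    show "AE x in lborel. (\<lambda>n. indicator {- real n..real n} x * exp (- u x)) \<longlonglongrightarrow> exp (- u x)"
    proof (rule AE_I2)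
      fix x :: real
      obtain N where N: "\<bar>x\<bar> \<le> real N" using real_arch_simple by blast
      have "\<forall>\<^sub>F n in sequentially. indicator {- real n..real n} x * exp (- u x) = exp (- u x)"
        using eventually_ge_at_top[of N] by eventually_elim (use N in \<open>auto simp: indicator_def\<close>)
      then show "(\<lambda>n. indicator {- real n..real n} x * exp (- u x)) \<longlonglongrightarrow> exp (- u x)"
        by (rule tendsto_eventually)
    qed
  qed (auto simp: indicator_def)
  then show ?thesis by (simp add: integral_Icc[OF weight_cont] partition_function_def)
qed

lemma partition_function_pos: "0 < partition_function u"
proof -
  have "0 < integral {0..1} (\<lambda>x. exp (- u x))"
    by (rule integral_pos_of_continuous[OF _ weight_cont]) auto
  also have "\<dots> \<le> partition_function u"
    unfolding integral_Icc[OF weight_cont] partition_function_def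
  proof (rule integral_mono[OF _ weight_integrable])
    show "integrable lborel (\<lambda>x. indicator {0..1} x * exp (- u x))"
      using borel_integrable_atLeastAtMost'[OF weight_cont, of 0 1] by (simp add: set_integrable_def)
  qed (auto simp: indicator_def)
  finally show ?thesis .
qed

lemma gibbs_integral:
  fixes f :: "real \<Rightarrow> real"
  assumes [measurable]: "f \<in> borel_measurable borel"
  shows "(LINT x|gibbs u. f x) = (LINT x|lborel. f x * exp (- u x)) / partition_function u"
proof -
  have "(LINT x|gibbs u. f x) = (LINT x|lborel. (exp (- u x) / partition_function u) *\<^sub>R f x)"
    unfolding gibbs_def using partition_function_pos by (subst integral_density) auto
  then show ?thesis by (simp add: mult.commute)
qed

lemma space_gibbs [simp]: "space (gibbs u) = UNIV" and sets_gibbs [simp, measurable_cong]: "sets (gibbs u) = sets borel"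
  by (simp_all add: gibbs_def)

sublocale prob_space "gibbs u"
proof
  have "emeasure (gibbs u) (space (gibbs u)) = (\<integral>\<^sup>+x. ennreal (exp (- u x) / partition_function u) \<partial>lborel)"
    unfolding gibbs_def by (subst emeasure_density) (auto simp: indicator_def)
  also have "\<dots> = ennreal (LINT x|lborel. exp (- u x) / partition_function u)"
    using weight_integrable partition_function_pos by (intro nn_integral_eq_integral) auto
  also have "\<dots> = 1"
    using partition_function_pos by (simp add: partition_function_def)
  finally show "emeasure (gibbs u) (space (gibbs u)) = 1" .
qed

lemma integrable_bounded:
  fixes f :: "real \<Rightarrow> real"
  assumes "f \<in> borel_measurable borel" "\<And>x. \<bar>f x\<bar> \<le> B"
  shows "integrable (gibbs u) f"
  using assms by (intro integrable_const_bound[where B = B]) auto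

end

lemma test_function_support:
  assumes "f \<in> test_functions"
  obtains R where "0 < R" "\<And>x. R < \<bar>x\<bar> \<Longrightarrow> f x = 0 \<and> deriv f x = 0"
proof -
  have "bounded (closure {x. f x \<noteq> 0})"
    using assms compact_imp_bounded by (auto simp: test_functions_def)
  then obtain R where R: "0 < R" "\<And>x. x \<in> closure {x. f x \<noteq> 0} \<Longrightarrow> norm x \<le> R"
    unfolding bounded_pos by auto
  have zero: "f x = 0" if "R < \<bar>x\<bar>" for x
    using R(2)[of x] closure_subset[of "{x. f x \<noteq> 0}"] that by fastforce
  have "deriv f x = 0" if "R < \<bar>x\<bar>" for x
  proof -
    have "open {y::real. R < \<bar>y\<bar>}" by (intro open_Collect_less continuous_intros)
    then have "\<forall>\<^sub>F y in nhds x. y \<in> {y. R < \<bar>y\<bar>}" using that by (intro eventually_nhds_in_open) auto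
    then have "\<forall>\<^sub>F y in nhds x. f y = (\<lambda>_. 0) y" by (rule eventually_mono) (use zero in auto)
    then have "deriv f x = deriv (\<lambda>_. 0) x" by (intro deriv_cong_ev) auto
    then show ?thesis by simp
  qed
  then show thesis using that R(1) zero by blast
qed

text \<open>The class to which the inequalities for test functions extend by cutoff. It contains the
perturbations \<open>1 + \<epsilon>\<phi>\<close> of constants and the steps between \<open>-1\<close> and \<open>1\<close>, neither of which has
compact support.\<close>

definition bounded_smooth :: "(real \<Rightarrow> real) \<Rightarrow> bool" where
  "bounded_smooth f \<longleftrightarrow> smooth f \<and> bounded (range f) \<and> bounded (range (deriv f))"

lemma bounded_smoothE:
  assumes "bounded_smooth f"
  obtains B where "0 < B" "\<And>x. \<bar>f x\<bar> \<le> B" "\<And>x. \<bar>deriv f x\<bar> \<le> B"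
proof -
  obtain B1 B2 where "0 < B1" "\<forall>x. \<bar>f x\<bar> \<le> B1" "0 < B2" "\<forall>x. \<bar>deriv f x\<bar> \<le> B2"
    using assms unfolding bounded_smooth_def bounded_pos by auto
  then show thesis by (intro that[of "max B1 B2"]) (auto simp: le_max_iff_disj)
qed

lemma bounded_smoothI:
  assumes "smooth f" "\<And>x. \<bar>f x\<bar> \<le> B" "\<And>x. \<bar>deriv f x\<bar> \<le> C"
  shows "bounded_smooth f"
  using assms unfolding bounded_smooth_def bounded_iff by auto

lemma test_function_bounded_smooth:
  assumes "f \<in> test_functions"
  shows "bounded_smooth f"
proof -
  have sm: "smooth f" using assms by (simp add: test_functions_def)
  obtain R where R: "0 < R" "\<And>x. R < \<bar>x\<bar> \<Longrightarrow> f x = 0 \<and> deriv f x = 0"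
    using test_function_support[OF assms] by blast
  have "bounded (range g)" if "continuous_on {-R..R} g" "\<And>x. R < \<bar>x\<bar> \<Longrightarrow> g x = 0" for g :: "real \<Rightarrow> real"
  proof -
    have "range g \<subseteq> g ` {-R..R} \<union> {0}"
      using that(2) by (force simp: not_le abs_le_iff)
    moreover have "bounded (g ` {-R..R} \<union> {0})"
      using that(1) by (simp add: compact_imp_bounded compact_continuous_image)
    ultimately show ?thesis by (rule bounded_subset[rotated])
  qed
  then show ?thesis
    using R(2) sm smooth_continuous smoothD(2)[OF sm] by (auto simp: bounded_smooth_def)
qed

lemma continuous_on_power2_ln: 
  assumes "continuous_on A (f :: 'a::topological_space \<Rightarrow> real)"
  shows "continuous_on A (\<lambda>x. (f x)\<^sup>2 * ln ((f x)\<^sup>2))"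
  by (rule continuous_on_compose2[OF continuous_on_x_ln_x]) (auto intro!: continuous_intros assms)

context gibbs_potential
begin

text \<open>For a test function all integrals over \<open>[-n,n]\<close> are eventually constant except for the partition
function, which converges; hence a constant that works on all intervals works on the line.\<close>

lemma log_sobolev_from_intervals:
  assumes intervals: "\<And>n f f'. 0 < n \<Longrightarrow> (\<And>x. (f has_real_derivative f' x) (at x)) \<Longrightarrow> continuous_on UNIV f' \<Longrightarrow>
      interval_entropy (- real n) (real n) (\<lambda>x. exp (- u x)) (\<lambda>x. (f x)\<^sup>2)
      \<le> C * integral {- real n..real n} (\<lambda>x. (f' x)\<^sup>2 * exp (- u x))"
    and f: "f \<in> test_functions"
  shows "Ent (gibbs u) (\<lambda>x. (f x)\<^sup>2) \<le> C * dirichlet_form u f"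
proof -
  have sm: "smooth f" using f by (simp add: test_functions_def)
  note f_cont = smooth_continuous[OF sm] and f'_cont = smooth_continuous[OF smoothD(2)[OF sm]]
  obtain R where R: "0 < R" "\<And>x. R < \<bar>x\<bar> \<Longrightarrow> f x = 0 \<and> deriv f x = 0"
    using test_function_support[OF f] by blast
  define Z where "Z = partition_function u"
  have Z: "0 < Z" using partition_function_pos by (simp add: Z_def)
  define L where "L = (LINT x|lborel. (f x)\<^sup>2 * ln ((f x)\<^sup>2) * exp (- u x))"
  define A where "A = (LINT x|lborel. (f x)\<^sup>2 * exp (- u x))"
  define D where "D = (LINT x|lborel. (deriv f x)\<^sup>2 * exp (- u x))"
  define Zn where "Zn n = integral {- real n..real n} (\<lambda>x. exp (- u x))" for n
  have A: "0 \<le> A" unfolding A_def by (rule integral_nonneg_AE) auto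
  have large: "L - A * ln (A / Zn n) \<le> C * D" if "R < real n" for n
  proof -
    have out: "f x = 0 \<and> deriv f x = 0" if "x \<notin> {- real n..real n}" for x
      using that \<open>R < real n\<close> by (intro R(2)) auto
    have "integral {- real n..real n} (\<lambda>x. (f x)\<^sup>2 * ln ((f x)\<^sup>2) * exp (- u x)) = L"
      unfolding L_def
      by (rule integral_Icc_eq_LINT) (auto intro!: continuous_on_mult continuous_on_power2_ln f_cont weight_cont simp: out)
    moreover have "integral {- real n..real n} (\<lambda>x. (f x)\<^sup>2 * exp (- u x)) = A"
      unfolding A_def by (rule integral_Icc_eq_LINT) (auto intro!: continuous_intros f_cont u_cont_on simp: out)
    moreover have "integral {- real n..real n} (\<lambda>x. (deriv f x)\<^sup>2 * exp (- u x)) = D"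
      unfolding D_def by (rule integral_Icc_eq_LINT) (auto intro!: continuous_intros f'_cont u_cont_on simp: out)
    moreover have "0 < n" using that R(1) by (cases n) auto
    ultimately show ?thesis
      using intervals[of n f "deriv f"] smoothD(1)[OF sm] f'_cont
      by (simp add: interval_entropy_def Zn_def)
  qed
  have "(\<lambda>n. L - A * ln (A / Zn n)) \<longlonglongrightarrow> L - A * ln (A / Z)"
  proof (cases "A = 0")
    case False
    then show ?thesis
      using weight_integral_tendsto A Z by (auto intro!: tendsto_intros simp: Zn_def Z_def)
  qed simp
  moreover have "\<forall>\<^sub>F n in sequentially. L - A * ln (A / Zn n) \<le> C * D"
  proof -
    obtain N where N: "R < real N" using reals_Archimedean2 by blast
    show ?thesis
      using eventually_ge_at_top[of N] by eventually_elim (use N in \<open>auto intro!: large\<close>)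
  qed
  ultimately have le: "L - A * ln (A / Z) \<le> C * D"
    by (rule tendsto_upperbound) simp
  have "Ent (gibbs u) (\<lambda>x. (f x)\<^sup>2) = (L - A * ln (A / Z)) / Z"
  proof -
    have [measurable]: "f \<in> borel_measurable borel"
      using f_cont by (rule borel_measurable_continuous_onI)
    show ?thesis by (simp add: Ent_def gibbs_integral L_def A_def Z_def diff_divide_distrib)
  qed
  also have "\<dots> \<le> C * D / Z" using le Z by (simp add: divide_right_mono)
  also have "\<dots> = C * dirichlet_form u f"
  proof -
    have [measurable]: "deriv f \<in> borel_measurable borel"
      using f'_cont by (rule borel_measurable_continuous_onI)
    show ?thesis by (simp add: dirichlet_form_def gibbs_integral D_def Z_def)
  qed
  finally show ?thesis .
qed

text \<open>Near every point the truncated functions are eventually equal to \<open>g\<close>, and they and their derivatives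
are uniformly bounded, so dominated convergence applies to every continuous expression in function
and derivative. Energy, moments and the entropy integrand are all of this form.\<close>

lemma cutoff_integral_tendsto:
  fixes \<Phi> :: "real \<Rightarrow> real \<Rightarrow> real"
  assumes g: "bounded_smooth g" and \<Phi>: "continuous_on UNIV (\<lambda>p. \<Phi> (fst p) (snd p))"
  shows "(\<lambda>n. LINT x|gibbs u. \<Phi> (g x * cutoff n x) (deriv (\<lambda>x. g x * cutoff n x) x))
    \<longlonglongrightarrow> (LINT x|gibbs u. \<Phi> (g x) (deriv g x))"
proof -
  have sm: "smooth g" using g by (simp add: bounded_smooth_def)
  obtain B where B: "0 < B" "\<And>x. \<bar>g x\<bar> \<le> B" "\<And>x. \<bar>deriv g x\<bar> \<le> B"
    using bounded_smoothE[OF g] by blast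
  define c where "c = 4 * exp (4 / 3 :: real)"
  have smn: "smooth (\<lambda>x. g x * cutoff n x)" for n
    by (intro smooth_mult sm smooth_cutoff)
  have dn: "deriv (\<lambda>x. g x * cutoff n x) x = deriv g x * cutoff n x + g x * deriv (cutoff n) x" for n x
    by (rule DERIV_imp_deriv)
       (use DERIV_mult[OF smoothD(1)[OF sm] smoothD(1)[OF smooth_cutoff]] in \<open>simp add: mult.commute\<close>)
  have "compact ({- B..B} \<times> {- (B + B * c)..B + B * c})" by (intro compact_Times compact_Icc)
  then have "bounded ((\<lambda>p. \<Phi> (fst p) (snd p)) ` ({- B..B} \<times> {- (B + B * c)..B + B * c}))"
    using \<Phi> by (intro compact_imp_bounded compact_continuous_image) (auto intro: continuous_on_subset)
  then obtain M where M: "\<And>s t. \<bar>s\<bar> \<le> B \<Longrightarrow> \<bar>t\<bar> \<le> B + B * c \<Longrightarrow> \<bar>\<Phi> s t\<bar> \<le> M"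
    unfolding bounded_iff by (force simp: abs_le_iff)
  have meas: "(\<lambda>x. \<Phi> (f x) (deriv f x)) \<in> borel_measurable (gibbs u)" if "smooth f" for f
  proof -
    have "continuous_on UNIV (\<lambda>x. \<Phi> (f x) (deriv f x))"
      using continuous_on_compose2[OF \<Phi>, of UNIV "\<lambda>x. (f x, deriv f x)"]
        smooth_continuous[OF that] smooth_continuous[OF smoothD(2)[OF that]]
      by (auto intro!: continuous_on_Pair)
    then show ?thesis by (simp add: borel_measurable_continuous_onI gibbs_def)
  qed
  show ?thesis
  proof (rule integral_dominated_convergence[where w = "\<lambda>_. M"])
    show "AE x in gibbs u. (\<lambda>n. \<Phi> (g x * cutoff n x) (deriv (\<lambda>x. g x * cutoff n x) x)) \<longlonglongrightarrow> \<Phi> (g x) (deriv g x)"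
    proof (rule AE_I2)
      fix x
      obtain N where N: "\<bar>x\<bar> \<le> real N" using real_arch_simple by blast
      have "\<forall>\<^sub>F n in sequentially. \<Phi> (g x * cutoff n x) (deriv (\<lambda>x. g x * cutoff n x) x) = \<Phi> (g x) (deriv g x)"
        using eventually_ge_at_top[of N]
      proof eventually_elim
        case (elim n)
        then have "\<bar>x\<bar> \<le> real n" using N by simp
        then show ?case by (simp add: dn cutoff_eq_1 deriv_cutoff_eq_0)
      qed
      then show "(\<lambda>n. \<Phi> (g x * cutoff n x) (deriv (\<lambda>x. g x * cutoff n x) x)) \<longlonglongrightarrow> \<Phi> (g x) (deriv g x)"
        by (rule tendsto_eventually)
    qed
    fix n
    show "AE x in gibbs u. norm (\<Phi> (g x * cutoff n x) (deriv (\<lambda>x. g x * cutoff n x) x)) \<le> M"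
    proof (rule AE_I2)
      fix x
      have 1: "\<bar>y * cutoff n x\<bar> \<le> B" if "\<bar>y\<bar> \<le> B" for y
        using mult_mono[OF that, of "cutoff n x" 1] cutoff_bounds[of n x] B(1) by (simp add: abs_mult)
      have "\<bar>g x * deriv (cutoff n) x\<bar> \<le> B * c"
        unfolding abs_mult c_def using B by (intro mult_mono deriv_cutoff_le) auto
      then have "\<bar>deriv g x * cutoff n x + g x * deriv (cutoff n) x\<bar> \<le> B + B * c"
        using 1[OF B(3)[of x]] by linarith
      then show "norm (\<Phi> (g x * cutoff n x) (deriv (\<lambda>x. g x * cutoff n x) x)) \<le> M"
        unfolding dn real_norm_def by (intro M 1 B(2))
    qed
  qed (auto intro: meas sm smn)
qed

lemma bounded_smooth_integrable:
  assumes "bounded_smooth g"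
  shows "integrable (gibbs u) g" "integrable (gibbs u) (\<lambda>x. (g x)\<^sup>2)"
proof -
  obtain B where B: "0 < B" "\<And>x. \<bar>g x\<bar> \<le> B"
    using bounded_smoothE[OF assms] by metis
  have [measurable]: "g \<in> borel_measurable borel"
    using assms by (intro borel_measurable_continuous_onI smooth_continuous) (simp add: bounded_smooth_def)
  show "integrable (gibbs u) g" by (rule integrable_bounded[OF _ B(2)]) measurable
  show "integrable (gibbs u) (\<lambda>x. (g x)\<^sup>2)"
    by (rule integrable_bounded[of _ "B\<^sup>2"]) (use B in \<open>auto intro!: power2_le_iff_abs_le[THEN iffD2]\<close>)
qed

lemma dirichlet_form_cutoff_tendsto:
  assumes "bounded_smooth g"
  shows "(\<lambda>n. dirichlet_form u (\<lambda>x. g x * cutoff n x)) \<longlonglongrightarrow> dirichlet_form u g"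
  unfolding dirichlet_form_def
  using cutoff_integral_tendsto[OF assms, of "\<lambda>s t. t\<^sup>2"] by (simp add: continuous_intros)

lemma poincare_extends:
  assumes adm: "\<forall>f\<in>test_functions. \<kappa> * variance f \<le> dirichlet_form u f"
    and g: "bounded_smooth g"
  shows "\<kappa> * variance g \<le> dirichlet_form u g"
proof (rule tendsto_le[OF sequentially_bot dirichlet_form_cutoff_tendsto[OF g]])
  define gn where "gn n x = g x * cutoff n x" for n x
  have test: "gn n \<in> test_functions" for n
    unfolding gn_def using g cutoff_mult_test_function by (simp add: bounded_smooth_def)
  have "(\<lambda>n. expectation (gn n)) \<longlonglongrightarrow> expectation g"
       "(\<lambda>n. expectation (\<lambda>x. (gn n x)\<^sup>2)) \<longlonglongrightarrow> expectation (\<lambda>x. (g x)\<^sup>2)"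
    using cutoff_integral_tendsto[OF g, of "\<lambda>s t. s"] cutoff_integral_tendsto[OF g, of "\<lambda>s t. s\<^sup>2"]
    by (simp_all add: continuous_intros gn_def[abs_def])
  then have "(\<lambda>n. \<kappa> * (expectation (\<lambda>x. (gn n x)\<^sup>2) - (expectation (gn n))\<^sup>2))
      \<longlonglongrightarrow> \<kappa> * (expectation (\<lambda>x. (g x)\<^sup>2) - (expectation g)\<^sup>2)"
    by (intro tendsto_intros)
  then show "(\<lambda>n. \<kappa> * variance (gn n)) \<longlonglongrightarrow> \<kappa> * variance g"
    using variance_eq[OF bounded_smooth_integrable[OF g]]
      variance_eq[OF bounded_smooth_integrable[OF test_function_bounded_smooth[OF test]]] by simp
  show "\<forall>\<^sub>F n in sequentially. \<kappa> * variance (gn n) \<le> dirichlet_form u (\<lambda>x. g x * cutoff n x)"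
    using adm[rule_format, OF test] unfolding gn_def[abs_def] by (intro always_eventually allI)
qed

lemma log_sobolev_extends:
  assumes adm: "\<forall>f\<in>test_functions. \<sigma> * Ent (gibbs u) (\<lambda>x. (f x)\<^sup>2) \<le> 2 * dirichlet_form u f"
    and g: "bounded_smooth g" and pos: "0 < expectation (\<lambda>x. (g x)\<^sup>2)"
  shows "\<sigma> * Ent (gibbs u) (\<lambda>x. (g x)\<^sup>2) \<le> 2 * dirichlet_form u g"
proof (rule tendsto_le[OF sequentially_bot tendsto_mult_left[OF dirichlet_form_cutoff_tendsto[OF g]]])
  define gn where "gn n x = g x * cutoff n x" for n x
  have test: "gn n \<in> test_functions" for n
    unfolding gn_def using g cutoff_mult_test_function by (simp add: bounded_smooth_def)
  have "(\<lambda>n. expectation (\<lambda>x. (gn n x)\<^sup>2 * ln ((gn n x)\<^sup>2))) \<longlonglongrightarrow> expectation (\<lambda>x. (g x)\<^sup>2 * ln ((g x)\<^sup>2))"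
       "(\<lambda>n. expectation (\<lambda>x. (gn n x)\<^sup>2)) \<longlonglongrightarrow> expectation (\<lambda>x. (g x)\<^sup>2)"
    using cutoff_integral_tendsto[OF g, of "\<lambda>s t. s\<^sup>2 * ln (s\<^sup>2)"] cutoff_integral_tendsto[OF g, of "\<lambda>s t. s\<^sup>2"]
    by (simp_all add: continuous_intros continuous_on_power2_ln gn_def[abs_def])
  then show "(\<lambda>n. \<sigma> * Ent (gibbs u) (\<lambda>x. (gn n x)\<^sup>2)) \<longlonglongrightarrow> \<sigma> * Ent (gibbs u) (\<lambda>x. (g x)\<^sup>2)"
    unfolding Ent_def using pos by (intro tendsto_intros) auto
  show "\<forall>\<^sub>F n in sequentially. \<sigma> * Ent (gibbs u) (\<lambda>x. (gn n x)\<^sup>2) \<le> 2 * dirichlet_form u (\<lambda>x. g x * cutoff n x)"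
    using adm[rule_format, OF test] unfolding gn_def[abs_def] by (intro always_eventually allI)
qed

end

section \<open>The optimal constants\<close>

text \<open>The admissible constants form a closed set containing \<open>0\<close>. The supremum is at least \<open>0\<close>, so it stays
admissible even for those \<open>f\<close> with \<open>v f \<le> 0\<close>.\<close>

lemma Greatest_constant:
  fixes v d :: "'a \<Rightarrow> real"
  assumes d: "\<And>f. f \<in> S \<Longrightarrow> 0 \<le> d f" and bdd: "bdd_above {\<kappa>. \<forall>f\<in>S. \<kappa> * v f \<le> d f}"
  shows Greatest_constant_admissible: "\<forall>f\<in>S. (GREATEST \<kappa>. \<forall>f\<in>S. \<kappa> * v f \<le> d f) * v f \<le> d f"
    and Greatest_constant_upper: "\<forall>f\<in>S. \<kappa> * v f \<le> d f \<Longrightarrow> \<kappa> \<le> (GREATEST \<kappa>. \<forall>f\<in>S. \<kappa> * v f \<le> d f)"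
proof -
  define P where "P \<kappa> = (\<forall>f\<in>S. \<kappa> * v f \<le> d f)" for \<kappa>
  define s where "s = Sup {\<kappa>. P \<kappa>}"
  have bdd': "bdd_above {\<kappa>. P \<kappa>}" using bdd by (simp add: P_def)
  have P0: "P 0" using d by (simp add: P_def)
  have upper: "\<kappa> \<le> s" if "P \<kappa>" for \<kappa>
    unfolding s_def using that bdd' by (intro cSup_upper) auto
  have s_nonneg: "0 \<le> s" by (rule upper[OF P0])
  have "P s"
    unfolding P_def
  proof
    fix f assume f: "f \<in> S"
    show "s * v f \<le> d f"
    proof (cases "0 < v f")
      case True
      have "s \<le> d f / v f"
        unfolding s_def
      proof (rule cSup_least)
        show "{\<kappa>. P \<kappa>} \<noteq> {}" using P0 by blast
        fix \<kappa> assume "\<kappa> \<in> {\<kappa>. P \<kappa>}"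
        then show "\<kappa> \<le> d f / v f" using True f by (simp add: P_def field_simps)
      qed
      then show ?thesis using True by (simp add: field_simps)
    next
      case False
      then have "s * v f \<le> 0" using s_nonneg by (simp add: mult_nonneg_nonpos)
      then show ?thesis using d[OF f] by linarith
    qed
  qed
  then have "(GREATEST \<kappa>. P \<kappa>) = s" by (rule Greatest_equality) (rule upper)
  then show "\<forall>f\<in>S. (GREATEST \<kappa>. \<forall>f\<in>S. \<kappa> * v f \<le> d f) * v f \<le> d f"
    and "\<forall>f\<in>S. \<kappa> * v f \<le> d f \<Longrightarrow> \<kappa> \<le> (GREATEST \<kappa>. \<forall>f\<in>S. \<kappa> * v f \<le> d f)"
    using \<open>P s\<close> upper[of \<kappa>] by (simp_all add: P_def)
qed

text \<open>The right-hand side dominates its third Taylor polynomial at \<open>1\<close> because its fourth derivative is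
positive; after two differentiations the difference becomes \<open>(s-1)\<^sup>2/s\<close>.\<close>

lemma x_ln_x_ge_cubic:
  fixes s :: real
  assumes "0 \<le> s"
  shows "(s - 1) + (s - 1)\<^sup>2 / 2 - (s - 1) ^ 3 / 6 \<le> s * ln s"
proof (cases "s = 0")
  case False
  then have s: "0 < s" using assms by simp
  define H where "H s = s * ln s - (s - 1) - (s - 1)\<^sup>2 / 2 + (s - 1) ^ 3 / 6" for s :: real
  define q where "q s = ln s - (s - 1) + (s - 1)\<^sup>2 / 2" for s :: real
  have H: "(H has_real_derivative q x) (at x)" if "0 < x" for x
    unfolding H_def q_def using that by (auto intro!: derivative_eq_intros simp: field_simps power2_eq_square)
  have q: "(q has_real_derivative (x - 1)\<^sup>2 / x) (at x)" if "0 < x" for x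
    unfolding q_def using that by (auto intro!: derivative_eq_intros simp: field_simps power2_eq_square)
  have q_mono: "q x \<le> q y" if "0 < x" "x \<le> y" for x y
  proof (rule DERIV_nonneg_imp_nondecreasing[OF that(2)])
    fix z assume "x \<le> z" "z \<le> y"
    then show "\<exists>d. (q has_real_derivative d) (at z) \<and> 0 \<le> d"
      using q[of z] that by (intro exI[of _ "(z - 1)\<^sup>2 / z"]) auto
  qed
  have q1: "q 1 = 0" by (simp add: q_def)
  have "H 1 \<le> H s"
  proof (cases "s \<le> 1")
    case True
    show ?thesis
    proof (rule DERIV_nonpos_imp_nonincreasing[OF True])
      fix z assume "s \<le> z" "z \<le> 1"
      then show "\<exists>d. (H has_real_derivative d) (at z) \<and> d \<le> 0"
        using H[of z] q_mono[of z 1] q1 s by (intro exI[of _ "q z"]) auto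
    qed
  next
    case False
    then have "1 \<le> s" by simp
    then show ?thesis
    proof (rule DERIV_nonneg_imp_nondecreasing)
      fix z assume "1 \<le> z" "z \<le> s"
      then show "\<exists>d. (H has_real_derivative d) (at z) \<and> 0 \<le> d"
        using H[of z] q_mono[of 1 z] q1 by (intro exI[of _ "q z"]) auto
    qed
  qed
  then show ?thesis by (simp add: H_def)
qed (simp add: power2_eq_square)

lemma square_ln_square_ge:
  fixes t r :: real
  assumes "\<bar>t\<bar> \<le> r" "r \<le> 1"
  shows "2 * t + 3 * t\<^sup>2 - 4 * r ^ 3 \<le> (1 + t)\<^sup>2 * ln ((1 + t)\<^sup>2)"
proof -
  have le: "\<bar>t ^ (3 + k)\<bar> \<le> r ^ 3" for k
  proof -
    have "\<bar>t ^ (3 + k)\<bar> = \<bar>t\<bar> ^ 3 * \<bar>t\<bar> ^ k" by (simp add: power_add abs_mult power_abs)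
    also have "\<dots> \<le> r ^ 3 * 1"
      using assms by (intro mult_mono power_mono power_le_one) auto
    finally show ?thesis by simp
  qed
  define s where "s = (1 + t)\<^sup>2"
  have "2 * t + 3 * t\<^sup>2 - 4 * r ^ 3 \<le> 2 * t + 3 * t\<^sup>2 + 2 / 3 * t ^ 3 - 3 / 2 * t ^ 4 - t ^ 5 - t ^ 6 / 6"
    using le[of 0] le[of 1] le[of 2] le[of 3] by (simp add: abs_le_iff)
  also have "\<dots> = (s - 1) + (s - 1)\<^sup>2 / 2 - (s - 1) ^ 3 / 6"
    unfolding s_def by (simp add: field_simps power2_eq_square power3_eq_cube power_numeral_reduce)
  also have "\<dots> \<le> s * ln s" by (rule x_ln_x_ge_cubic) (simp add: s_def)
  finally show ?thesis by (simp add: s_def)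
qed

context gibbs_potential
begin

lemma prob_UNIV: "prob UNIV = 1"
  using prob_space by simp

lemma dirichlet_form_nonneg: "0 \<le> dirichlet_form u f"
  unfolding dirichlet_form_def by (rule integral_nonneg_AE) auto

text \<open>Linearisation at constants. For \<open>\<phi> = f - m\<close> of mean zero and small \<open>\<epsilon>\<close>, the entropy of
\<open>(1 + \<epsilon>\<phi>)\<^sup>2\<close> is \<open>2\<epsilon>\<^sup>2\<close> times the variance of \<open>f\<close> up to \<open>O(\<epsilon>\<^sup>3)\<close>, while the energy is
\<open>\<epsilon>\<^sup>2\<close> times that of \<open>f\<close>.\<close>

lemma log_sobolev_imp_poincare:
  assumes adm: "\<forall>f\<in>test_functions. \<sigma> * Ent (gibbs u) (\<lambda>x. (f x)\<^sup>2) \<le> 2 * dirichlet_form u f"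
    and f: "f \<in> test_functions"
  shows "\<sigma> * variance f \<le> dirichlet_form u f"
proof (cases "\<sigma> \<le> 0")
  case True
  then have "\<sigma> * variance f \<le> 0" by (intro mult_nonpos_nonneg variance_positive)
  then show ?thesis using dirichlet_form_nonneg[of f] by linarith
next
  case False
  have bsm: "bounded_smooth f" by (rule test_function_bounded_smooth[OF f])
  then have sm: "smooth f" by (simp add: bounded_smooth_def)
  obtain B where B: "0 < B" "\<And>x. \<bar>f x\<bar> \<le> B" "\<And>x. \<bar>deriv f x\<bar> \<le> B"
    using bounded_smoothE[OF bsm] by blast
  define m where "m = expectation f"
  define \<phi> where "\<phi> x = f x - m" for x
  define C where "C = B + \<bar>m\<bar>"
  have C: "0 < C" using B(1) by (simp add: C_def)
  have \<phi>_le: "\<bar>\<phi> x\<bar> \<le> C" for x using B(2)[of x] by (simp add: \<phi>_def C_def)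
  have \<phi>_smooth: "smooth \<phi>" using smooth_add[OF sm smooth_const[of "- m"]] by (simp add: \<phi>_def[abs_def])
  have \<phi>_deriv: "deriv \<phi> = deriv f"
    unfolding \<phi>_def[abs_def] using smoothD(1)[OF sm] by (intro ext DERIV_imp_deriv) (auto intro!: derivative_eq_intros)
  have bsm\<phi>: "bounded_smooth \<phi>" by (rule bounded_smoothI[OF \<phi>_smooth \<phi>_le]) (unfold \<phi>_deriv, rule B(3))
  note int\<phi> = bounded_smooth_integrable[OF bsm\<phi>]
  define v where "v = expectation (\<lambda>x. (\<phi> x)\<^sup>2)"
  have v: "0 \<le> v" unfolding v_def by (rule integral_nonneg_AE) auto
  have E\<phi>: "expectation \<phi> = 0"
    unfolding \<phi>_def using bounded_smooth_integrable(1)[OF bsm] by (simp add: m_def prob_UNIV)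
  define D where "D = dirichlet_form u f"
  have main: "\<sigma> * (2 * v - 4 * (\<epsilon> * C ^ 3) - \<epsilon>\<^sup>2 * v\<^sup>2) \<le> 2 * D" if \<epsilon>: "0 < \<epsilon>" "\<epsilon> \<le> 1 / C" for \<epsilon>
  proof -
    define g where "g x = 1 + \<epsilon> * \<phi> x" for x
    have g_smooth: "smooth g"
      unfolding g_def by (intro smooth_add smooth_mult smooth_const \<phi>_smooth)
    have g_deriv: "deriv g x = \<epsilon> * deriv f x" for x
      unfolding g_def[abs_def] using smoothD(1)[OF \<phi>_smooth] 
      by (intro DERIV_imp_deriv) (auto intro!: derivative_eq_intros simp: \<phi>_deriv)
    have t_le: "\<bar>\<epsilon> * \<phi> x\<bar> \<le> \<epsilon> * C" for x
      using \<epsilon> \<phi>_le[of x] by (simp add: abs_mult)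
    have bsmg: "bounded_smooth g"
    proof (rule bounded_smoothI[OF g_smooth])
      show "\<bar>g x\<bar> \<le> 1 + \<epsilon> * C" for x using t_le[of x] by (simp add: g_def)
      show "\<bar>deriv g x\<bar> \<le> \<epsilon> * B" for x using B(3)[of x] \<epsilon> by (simp add: g_deriv abs_mult)
    qed
    have Eg2: "expectation (\<lambda>x. (g x)\<^sup>2) = 1 + \<epsilon>\<^sup>2 * v"
    proof -
      have "(\<lambda>x. (g x)\<^sup>2) = (\<lambda>x. 1 + 2 * \<epsilon> * \<phi> x + \<epsilon>\<^sup>2 * (\<phi> x)\<^sup>2)"
        by (auto simp: g_def power2_eq_square algebra_simps)
      then show ?thesis using int\<phi> by (simp add: E\<phi> v_def prob_UNIV)
    qed
    have pos: "0 < 1 + \<epsilon>\<^sup>2 * v" using v by (simp add: add_pos_nonneg)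
    have cont: "continuous_on UNIV (\<lambda>x. (g x)\<^sup>2 * ln ((g x)\<^sup>2))"
      by (intro continuous_on_power2_ln smooth_continuous g_smooth)
    have "3 * (\<epsilon>\<^sup>2 * v) - 4 * (\<epsilon> * C) ^ 3 \<le> expectation (\<lambda>x. (g x)\<^sup>2 * ln ((g x)\<^sup>2))"
    proof -
      have "bounded ((\<lambda>s. s\<^sup>2 * ln (s\<^sup>2)) ` {- (1 + \<epsilon> * C)..1 + \<epsilon> * C})"
        by (intro compact_imp_bounded compact_continuous_image continuous_on_power2_ln continuous_on_id compact_Icc)
      then obtain M where M: "\<And>s. \<bar>s\<bar> \<le> 1 + \<epsilon> * C \<Longrightarrow> \<bar>s\<^sup>2 * ln (s\<^sup>2)\<bar> \<le> M"
        unfolding bounded_iff by (force simp: abs_le_iff)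
      have int: "integrable (gibbs u) (\<lambda>x. (g x)\<^sup>2 * ln ((g x)\<^sup>2))"
      proof (rule integrable_bounded[OF borel_measurable_continuous_onI[OF cont]])
        show "\<bar>(g x)\<^sup>2 * ln ((g x)\<^sup>2)\<bar> \<le> M" for x
          by (rule M) (use t_le[of x] in \<open>simp add: g_def\<close>)
      qed
      have "expectation (\<lambda>x. 2 * \<epsilon> * \<phi> x + 3 * \<epsilon>\<^sup>2 * (\<phi> x)\<^sup>2 - 4 * (\<epsilon> * C) ^ 3)
          \<le> expectation (\<lambda>x. (g x)\<^sup>2 * ln ((g x)\<^sup>2))"
      proof (rule integral_mono[OF _ int])
        fix x
        have "\<epsilon> * C \<le> 1" using \<epsilon> C by (simp add: field_simps)
        from square_ln_square_ge[OF t_le this, of x]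
        show "2 * \<epsilon> * \<phi> x + 3 * \<epsilon>\<^sup>2 * (\<phi> x)\<^sup>2 - 4 * (\<epsilon> * C) ^ 3 \<le> (g x)\<^sup>2 * ln ((g x)\<^sup>2)"
          by (simp add: g_def power_mult_distrib mult.assoc)
      qed (use int\<phi> in auto)
      then show ?thesis using int\<phi> by (simp add: E\<phi> v_def prob_UNIV)
    qed
    moreover have "(1 + \<epsilon>\<^sup>2 * v) * ln (1 + \<epsilon>\<^sup>2 * v) \<le> (1 + \<epsilon>\<^sup>2 * v) * (\<epsilon>\<^sup>2 * v)"
      using pos ln_le_minus_one[OF pos] by (intro mult_left_mono) auto
    ultimately have "3 * (\<epsilon>\<^sup>2 * v) - 4 * (\<epsilon> * C) ^ 3 - (1 + \<epsilon>\<^sup>2 * v) * (\<epsilon>\<^sup>2 * v)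
        \<le> Ent (gibbs u) (\<lambda>x. (g x)\<^sup>2)"
      unfolding Ent_def Eg2 by linarith
    moreover have "3 * (\<epsilon>\<^sup>2 * v) - 4 * (\<epsilon> * C) ^ 3 - (1 + \<epsilon>\<^sup>2 * v) * (\<epsilon>\<^sup>2 * v)
        = \<epsilon>\<^sup>2 * (2 * v - 4 * (\<epsilon> * C ^ 3) - \<epsilon>\<^sup>2 * v\<^sup>2)"
      by (simp add: algebra_simps power2_eq_square power3_eq_cube)
    ultimately have "\<epsilon>\<^sup>2 * (2 * v - 4 * (\<epsilon> * C ^ 3) - \<epsilon>\<^sup>2 * v\<^sup>2) \<le> Ent (gibbs u) (\<lambda>x. (g x)\<^sup>2)"
      by simp
    then have "\<sigma> * (\<epsilon>\<^sup>2 * (2 * v - 4 * (\<epsilon> * C ^ 3) - \<epsilon>\<^sup>2 * v\<^sup>2)) \<le> \<sigma> * Ent (gibbs u) (\<lambda>x. (g x)\<^sup>2)"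
      using False by (intro mult_left_mono) auto
    also have "\<dots> \<le> 2 * dirichlet_form u g"
      by (rule log_sobolev_extends[OF adm bsmg]) (simp only: Eg2 pos)
    also have "dirichlet_form u g = \<epsilon>\<^sup>2 * D"
      by (simp add: dirichlet_form_def D_def g_deriv power_mult_distrib)
    finally have "\<epsilon>\<^sup>2 * (\<sigma> * (2 * v - 4 * (\<epsilon> * C ^ 3) - \<epsilon>\<^sup>2 * v\<^sup>2)) \<le> \<epsilon>\<^sup>2 * (2 * D)"
      by (simp only: mult_ac)
    then show ?thesis using \<epsilon>(1) by (simp only: mult_le_cancel_left_pos zero_less_power)
  qed
  \<comment> \<open>The bound \<open>\<epsilon> \<le> 1/C\<close> kept \<open>\<epsilon>\<phi>\<close> within the range of the cubic estimate; now \<open>\<epsilon>\<close> tends to \<open>0\<close>.\<close>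
  have ev: "\<forall>\<^sub>F \<epsilon> in at_right 0. \<sigma> * (2 * v - 4 * (\<epsilon> * C ^ 3) - \<epsilon>\<^sup>2 * v\<^sup>2) \<le> 2 * D"
    unfolding eventually_at_right_field using main C by (intro exI[of _ "1 / C"]) auto
  have "((\<lambda>\<epsilon>. \<sigma> * (2 * v - 4 * (\<epsilon> * C ^ 3) - \<epsilon>\<^sup>2 * v\<^sup>2)) \<longlongrightarrow> \<sigma> * (2 * v - 4 * (0 * C ^ 3) - 0\<^sup>2 * v\<^sup>2)) (at_right 0)"
    by (intro tendsto_intros)
  then have "\<sigma> * (2 * v - 4 * (0 * C ^ 3) - 0\<^sup>2 * v\<^sup>2) \<le> 2 * D"
    by (rule tendsto_upperbound[OF _ ev]) (rule trivial_limit_at_right_real)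
  then show ?thesis by (simp add: v_def D_def \<phi>_def m_def)
qed

text \<open>The trial function is a smooth step from \<open>-1\<close> to \<open>1\<close> across \<open>[-\<delta>,\<delta>]\<close>. Its energy lives on that
interval, where the weight is at most \<open>W\<close>. Whatever its mean \<open>m\<close>, the two intervals at distance
\<open>p\<close> to \<open>p + h\<close> from \<open>0\<close> contribute at least \<open>L h ((1-m)\<^sup>2 + (1+m)\<^sup>2) \<ge> 2 L h\<close> to the
variance. The partition function cancels in the quotient.\<close>

lemma poincare_constant_le:
  assumes adm: "\<forall>f\<in>test_functions. \<kappa> * variance f \<le> dirichlet_form u f" and "0 \<le> \<kappa>"
    and p: "0 < \<delta>" "\<delta> \<le> p" "0 < h" "0 \<le> L"
    and L: "\<And>x. p \<le> \<bar>x\<bar> \<Longrightarrow> \<bar>x\<bar> \<le> p + h \<Longrightarrow> L \<le> exp (- u x)"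
    and W: "\<And>x. \<bar>x\<bar> \<le> \<delta> \<Longrightarrow> exp (- u x) \<le> W"
  shows "\<kappa> * (L * h) \<le> W * (2 * exp (4 / 3))\<^sup>2 / \<delta>"
proof -
  define c where "c = 2 * exp (4 / 3 :: real)"
  have c: "0 < c" by (simp add: c_def)
  define f where "f x = 2 * smooth_step (1 / (2 * \<delta>) * x + 1 / 2) + (- 1)" for x
  have sm: "smooth f"
    unfolding f_def by (intro smooth_add smooth_mult smooth_const smooth_compose_affine smooth_smooth_step)
  have f_deriv: "deriv f x = 1 / \<delta> * deriv smooth_step (1 / (2 * \<delta>) * x + 1 / 2)" for x
  proof (rule DERIV_imp_deriv)
    have "((\<lambda>x. 1 / (2 * \<delta>) * x + 1 / 2) has_real_derivative 1 / (2 * \<delta>)) (at x)"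
      using p(1) by (auto intro!: derivative_eq_intros)
    from DERIV_chain2[OF smoothD(1)[OF smooth_smooth_step] this]
    have *: "((\<lambda>x. smooth_step (1 / (2 * \<delta>) * x + 1 / 2)) has_real_derivative
      deriv smooth_step (1 / (2 * \<delta>) * x + 1 / 2) * (1 / (2 * \<delta>))) (at x)" .
    show "(f has_real_derivative 1 / \<delta> * deriv smooth_step (1 / (2 * \<delta>) * x + 1 / 2)) (at x)"
      unfolding f_def[abs_def] by (rule DERIV_cong[OF DERIV_add[OF DERIV_cmult[OF *] DERIV_const]]) simp
  qed
  have f_deriv_le: "\<bar>deriv f x\<bar> \<le> c / \<delta>" for x
    using smooth_step_deriv_le p(1) by (simp add: f_deriv c_def abs_mult divide_right_mono)
  have f_bound: "\<bar>f x\<bar> \<le> 1" for x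
    using smooth_step_nonneg smooth_step_le_1 by (simp add: f_def abs_le_iff)
  have f_right: "f x = 1" if "\<delta> \<le> x" for x
    using that p(1) by (simp add: f_def smooth_step_1 field_simps)
  have f_left: "f x = - 1" if "x \<le> - \<delta>" for x
    using that p(1) by (simp add: f_def smooth_step_0 field_simps)
  have f_deriv_0: "deriv f x = 0" if "\<delta> \<le> \<bar>x\<bar>" for x
    using that p(1) by (cases "0 \<le> x") (auto simp: f_deriv smooth_step_deriv_0 field_simps)
  have bsm: "bounded_smooth f" by (rule bounded_smoothI[OF sm f_bound f_deriv_le])
  have [measurable]: "f \<in> borel_measurable borel" "deriv f \<in> borel_measurable borel"
    using smooth_continuous[OF sm] smooth_continuous[OF smoothD(2)[OF sm]] by (auto intro: borel_measurable_continuous_onI)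
  define Z where "Z = partition_function u"
  have Z: "0 < Z" using partition_function_pos by (simp add: Z_def)
  define m where "m = expectation f"
  have weighted_integrable: "integrable lborel (\<lambda>x. r x * exp (- u x))"
    if [measurable]: "r \<in> borel_measurable borel" and "\<And>x. \<bar>r x\<bar> \<le> M" for r :: "real \<Rightarrow> real" and M
  proof (rule Bochner_Integration.integrable_bound)
    show "integrable lborel (\<lambda>x. M * exp (- u x))" using weight_integrable by simp
    show "AE x in lborel. norm (r x * exp (- u x)) \<le> norm (M * exp (- u x))"
      using that(2) by (intro AE_I2) (auto simp: abs_mult intro!: mult_right_mono order_trans[OF _ abs_ge_self])
  qed measurable
  have indicator_integrable: "integrable lborel (indicator {a..b} :: real \<Rightarrow> real)" for a b :: real
    by (rule integrable_real_indicator) (auto simp: emeasure_lborel_Icc_eq)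
  have "2 * L * h \<le> L * h * ((1 - m)\<^sup>2 + (1 + m)\<^sup>2)"
  proof -
    have "2 \<le> (1 - m)\<^sup>2 + (1 + m)\<^sup>2" by (simp add: power2_eq_square algebra_simps)
    from mult_left_mono[OF this, of "L * h"] p show ?thesis by (simp add: mult_ac)
  qed
  also have "\<dots> = (LINT x|lborel. L * (1 - m)\<^sup>2 * indicator {p..p + h} x + L * (1 + m)\<^sup>2 * indicator {- p - h..- p} x)"
    using p(3) by (simp add: algebra_simps)
  also have "\<dots> \<le> (LINT x|lborel. (f x - m)\<^sup>2 * exp (- u x))"
  proof (rule integral_mono)
    show "integrable lborel (\<lambda>x. (f x - m)\<^sup>2 * exp (- u x))"
    proof (rule weighted_integrable)
      show "\<bar>(f x - m)\<^sup>2\<bar> \<le> (1 + \<bar>m\<bar>)\<^sup>2" for x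
        using f_bound[of x] by (simp add: power2_le_iff_abs_le abs_triangle_ineq4[THEN order_trans])
    qed measurable
    fix x
    consider "p \<le> x" "x \<le> p + h" | "- p - h \<le> x" "x \<le> - p" | "x \<notin> {p..p + h}" "x \<notin> {- p - h..- p}"
      by fastforce
    then show "L * (1 - m)\<^sup>2 * indicator {p..p + h} x + L * (1 + m)\<^sup>2 * indicator {- p - h..- p} x
        \<le> (f x - m)\<^sup>2 * exp (- u x)"
    proof cases
      case 1
      then have "x \<notin> {- p - h..- p}" "f x = 1" "L \<le> exp (- u x)" using p L[of x] by (auto intro!: f_right)
      then show ?thesis using 1 by (simp add: mult.commute mult_right_mono)
    next
      case 2
      then have "x \<notin> {p..p + h}" "f x = - 1" "L \<le> exp (- u x)" using p L[of x] by (auto intro!: f_left)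
      moreover have "(- 1 - m)\<^sup>2 = (1 + m)\<^sup>2" by (simp add: power2_eq_square algebra_simps)
      ultimately show ?thesis using 2 by (simp add: mult.commute mult_right_mono)
    qed auto
  next
    show "integrable lborel (\<lambda>x. L * (1 - m)\<^sup>2 * indicator {p..p + h} x + L * (1 + m)\<^sup>2 * indicator {- p - h..- p} x)"
      by (intro Bochner_Integration.integrable_add integrable_mult_right indicator_integrable)
  qed
  also have "\<dots> = Z * variance f"
    using Z by (simp add: gibbs_integral m_def[symmetric] Z_def[symmetric])
  finally have "\<kappa> * (2 * L * h) \<le> \<kappa> * (Z * variance f)"
    using \<open>0 \<le> \<kappa>\<close> by (rule mult_left_mono)
  also have "\<dots> = Z * (\<kappa> * variance f)" by (simp only: mult.left_commute)
  also have "\<dots> \<le> Z * dirichlet_form u f"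
    using poincare_extends[OF adm bsm] Z by simp
  also have "\<dots> = (LINT x|lborel. (deriv f x)\<^sup>2 * exp (- u x))"
    using Z by (simp add: dirichlet_form_def gibbs_integral Z_def[symmetric])
  also have "\<dots> \<le> (LINT x|lborel. (c / \<delta>)\<^sup>2 * W * indicator {- \<delta>..\<delta>} x)"
  proof (rule integral_mono)
    show "integrable lborel (\<lambda>x. (deriv f x)\<^sup>2 * exp (- u x))"
      by (rule weighted_integrable[of _ "(c / \<delta>)\<^sup>2"])
         (use f_deriv_le c p(1) in \<open>auto simp: power2_le_iff_abs_le\<close>)
    fix x
    show "(deriv f x)\<^sup>2 * exp (- u x) \<le> (c / \<delta>)\<^sup>2 * W * indicator {- \<delta>..\<delta>} x"
    proof (cases "x \<in> {- \<delta>..\<delta>}")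
      case True
      then have "(deriv f x)\<^sup>2 * exp (- u x) \<le> (c / \<delta>)\<^sup>2 * W"
        using f_deriv_le[of x] c p(1) by (intro mult_mono W) (auto simp: power2_le_iff_abs_le)
      then show ?thesis using True by simp
    qed (use f_deriv_0[of x] in auto)
  qed (intro integrable_mult_right indicator_integrable)
  also have "\<dots> = 2 * (W * c\<^sup>2 / \<delta>)"
    using p(1) by (simp add: power2_eq_square field_simps)
  finally have "2 * (\<kappa> * (L * h)) \<le> 2 * (W * c\<^sup>2 / \<delta>)" by (simp only: mult_ac)
  then show ?thesis unfolding c_def by linarith
qed

text \<open>This is what makes the spectral gap a genuine maximum; the weight is bounded above and below by
positive constants on compact sets, so the step function above yields a finite bound.\<close>

lemma poincare_constants_bounded:
  "bdd_above {\<kappa>. \<forall>f\<in>test_functions. \<kappa> * variance f \<le> dirichlet_form u f}"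
proof -
  have "compact ({1..2} \<union> {-2..-1::real})" by (intro compact_Un compact_Icc)
  from continuous_attains_inf[OF this _ weight_cont] obtain y
    where y: "\<And>x. x \<in> {1..2} \<union> {-2..-1} \<Longrightarrow> exp (- u y) \<le> exp (- u x)" by (metis Un_empty atLeastatMost_empty_iff one_le_numeral)
  from continuous_attains_sup[OF compact_Icc _ weight_cont, of "-1" 1] obtain z
    where z: "\<And>x. x \<in> {-1..1} \<Longrightarrow> exp (- u x) \<le> exp (- u z)" by force
  show ?thesis
  proof (rule bdd_aboveI)
    fix \<kappa> assume \<kappa>: "\<kappa> \<in> {\<kappa>. \<forall>f\<in>test_functions. \<kappa> * variance f \<le> dirichlet_form u f}"
    have *: "\<kappa> \<le> exp (- u z) * (2 * exp (4 / 3))\<^sup>2 / exp (- u y)" if "0 \<le> \<kappa>"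
    proof -
      have "\<kappa> * (exp (- u y) * 1) \<le> exp (- u z) * (2 * exp (4 / 3))\<^sup>2 / 1"
      proof (rule poincare_constant_le[of \<kappa> 1 1 1])
        show "exp (- u y) \<le> exp (- u x)" if "1 \<le> \<bar>x\<bar>" "\<bar>x\<bar> \<le> 1 + 1" for x
          using that by (intro y) auto
        show "exp (- u x) \<le> exp (- u z)" if "\<bar>x\<bar> \<le> 1" for x
          using that by (intro z) auto
      qed (use \<kappa> that in auto)
      then show ?thesis by (simp only: pos_le_divide_eq exp_gt_zero mult_1_right div_by_1)
    qed
    have "0 \<le> exp (- u z) * (2 * exp (4 / 3))\<^sup>2 / exp (- u y)" by simp
    with * show "\<kappa> \<le> exp (- u z) * (2 * exp (4 / 3))\<^sup>2 / exp (- u y)" by linarith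
  qed
qed

lemma spectral_gap_admissible:
  "\<forall>f\<in>test_functions. spectral_gap u * variance f \<le> dirichlet_form u f"
  unfolding spectral_gap_def
  by (rule Greatest_constant_admissible[OF dirichlet_form_nonneg poincare_constants_bounded])

lemma spectral_gap_upper:
  assumes "\<forall>f\<in>test_functions. \<kappa> * variance f \<le> dirichlet_form u f"
  shows "\<kappa> \<le> spectral_gap u"
  unfolding spectral_gap_def
  by (rule Greatest_constant_upper[OF dirichlet_form_nonneg poincare_constants_bounded assms])

text \<open>Every logarithmic Sobolev constant is a Poincare constant, so boundedness is inherited.\<close>

lemma log_sobolev_constants_bounded:
  "bdd_above {\<sigma>. \<forall>f\<in>test_functions. \<sigma> * Ent (gibbs u) (\<lambda>x. (f x)\<^sup>2) \<le> 2 * dirichlet_form u f}"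
  by (rule bdd_above_mono[OF poincare_constants_bounded]) (use log_sobolev_imp_poincare in blast)

lemma log_sobolev_admissible:
  "\<forall>f\<in>test_functions. log_sobolev u * Ent (gibbs u) (\<lambda>x. (f x)\<^sup>2) \<le> 2 * dirichlet_form u f"
  unfolding log_sobolev_def
  by (rule Greatest_constant_admissible[OF _ log_sobolev_constants_bounded]) (simp add: dirichlet_form_nonneg)

lemma log_sobolev_upper:
  assumes "\<forall>f\<in>test_functions. \<sigma> * Ent (gibbs u) (\<lambda>x. (f x)\<^sup>2) \<le> 2 * dirichlet_form u f"
  shows "\<sigma> \<le> log_sobolev u"
  unfolding log_sobolev_def
  by (rule Greatest_constant_upper[OF _ log_sobolev_constants_bounded assms]) (simp add: dirichlet_form_nonneg)

lemma log_sobolev_le_spectral_gap: "log_sobolev u \<le> spectral_gap u"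
  by (rule spectral_gap_upper) (use log_sobolev_imp_poincare[OF log_sobolev_admissible] in blast)

end

section \<open>The quartic potential\<close>

text \<open>Integrability by comparison with a Gaussian: completing squares shows that the quartic exceeds
\<open>x\<^sup>2/2\<close> up to a constant.\<close>

lemma quartic_gibbs_potential: "gibbs_potential (quartic \<beta>1 \<beta>2)"
proof
  show cont: "continuous_on UNIV (quartic \<beta>1 \<beta>2)"
    unfolding quartic_def by (intro continuous_intros)
  define C where "C = (\<beta>1 + 1)\<^sup>2 / 4 + \<beta>2\<^sup>2 / 2"
  show "integrable lborel (\<lambda>x. exp (- quartic \<beta>1 \<beta>2 x))"
  proof (rule Bochner_Integration.integrable_bound)
    show "integrable lborel (\<lambda>x. exp C * sqrt (2 * pi) * std_normal_density x)" by simp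
    show "AE x in lborel. norm (exp (- quartic \<beta>1 \<beta>2 x)) \<le> norm (exp C * sqrt (2 * pi) * std_normal_density x)"
    proof (rule AE_I2)
      fix x :: real
      have "0 \<le> (x\<^sup>2 - (\<beta>1 + 1) / 2)\<^sup>2 + (x + \<beta>2)\<^sup>2 / 2" by simp
      also have "\<dots> = quartic \<beta>1 \<beta>2 x - x\<^sup>2 / 2 + C"
        by (simp add: quartic_def C_def field_simps power2_eq_square power_numeral_reduce)
      finally have "exp (- quartic \<beta>1 \<beta>2 x) \<le> exp (C + - (x\<^sup>2 / 2))" by simp
      also have "\<dots> = exp C * sqrt (2 * pi) * std_normal_density x"
        unfolding exp_add by (simp add: std_normal_density_def)
      finally show "norm (exp (- quartic \<beta>1 \<beta>2 x)) \<le> norm (exp C * sqrt (2 * pi) * std_normal_density x)"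
        by simp
    qed
    show "(\<lambda>x. exp (- quartic \<beta>1 \<beta>2 x)) \<in> borel_measurable lborel"
      using cont by (simp add: borel_measurable_continuous_onI continuous_intros)
  qed
qed

lemma has_derivative_max_0_square:
  "((\<lambda>z::real. (max 0 z)\<^sup>2) has_real_derivative 2 * max 0 z) (at z)"
proof (cases z "0 :: real" rule: linorder_cases)
  case less
  have "\<forall>\<^sub>F y in nhds z. (max 0 y)\<^sup>2 = 0"
    using eventually_nhds_in_open[of "{..<0}" z] less by (auto elim!: eventually_mono)
  then have "((\<lambda>z. (max 0 z)\<^sup>2) has_real_derivative 0) (at z)"
    by (subst DERIV_cong_ev[OF refl _ refl, where g = "\<lambda>_. 0"]) auto
  then show ?thesis using less by simp
next
  case greater
  have "\<forall>\<^sub>F y in nhds z. (max 0 y)\<^sup>2 = y\<^sup>2"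
    using eventually_nhds_in_open[of "{0<..}" z] greater by (auto elim!: eventually_mono)
  moreover have "((\<lambda>y. y\<^sup>2) has_real_derivative 2 * max 0 z) (at z)"
    using greater by (auto intro!: derivative_eq_intros)
  ultimately show ?thesis by (subst DERIV_cong_ev[OF refl _ refl, where g = "\<lambda>y. y\<^sup>2"]) auto
next
  case equal
  have "((\<lambda>h::real. (max 0 h)\<^sup>2 / h) \<longlongrightarrow> 0) (at 0)"
  proof (rule tendsto_rabs_zero_cancel, rule tendsto_sandwich[where f = "\<lambda>_. 0" and h = "\<lambda>h. \<bar>h\<bar>"])
    show "((\<lambda>h::real. \<bar>h\<bar>) \<longlongrightarrow> 0) (at 0)" by (rule tendsto_rabs_zero) (rule tendsto_ident_at)
    show "\<forall>\<^sub>F h :: real in at 0. \<bar>(max 0 h)\<^sup>2 / h\<bar> \<le> \<bar>h\<bar>"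
      by (auto simp: max_def power2_eq_square)
  qed auto
  then show ?thesis using equal by (simp add: DERIV_def)
qed

text \<open>With \<open>c = (\<beta>1 + K/2)/2\<close> the quartic is \<open>K x\<^sup>2/2 + \<beta>2 x + (x\<^sup>2 - c)\<^sup>2 - c\<^sup>2\<close>. The square is
split into its part outside the well \<open>x\<^sup>2 < c\<close>, which is convex and goes to \<open>V\<close>, and its part
inside, a perturbation with values in \<open>[0, c\<^sup>2]\<close>. The linear term does not affect convexity, so
the bound is uniform in \<open>\<beta>2\<close>.\<close>

lemma log_sobolev_quartic_ge:
  assumes K: "0 < K" and c: "0 \<le> \<beta>1 + K / 2"
  shows "K * exp (- (\<beta>1 + K / 2)\<^sup>2 / 4) \<le> log_sobolev (quartic \<beta>1 \<beta>2)"
proof -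
  interpret gibbs_potential "quartic \<beta>1 \<beta>2" by (rule quartic_gibbs_potential)
  define c where "c = (\<beta>1 + K / 2) / 2"
  define V where "V x = K / 2 * x\<^sup>2 + \<beta>2 * x + (max 0 (x\<^sup>2 - c))\<^sup>2 - c\<^sup>2" for x
  define V' where "V' x = K * x + \<beta>2 + 4 * x * max 0 (x\<^sup>2 - c)" for x
  define h where "h x = (min 0 (x\<^sup>2 - c))\<^sup>2" for x
  have c0: "0 \<le> c" using c by (simp add: c_def)
  have decomposition: "quartic \<beta>1 \<beta>2 x = V x + h x" for x
  proof -
    have "(max 0 (x\<^sup>2 - c))\<^sup>2 + (min 0 (x\<^sup>2 - c))\<^sup>2 = (x\<^sup>2 - c)\<^sup>2" by (simp add: max_def min_def)
    then show ?thesis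
      by (simp add: quartic_def V_def h_def c_def field_simps power2_eq_square power_numeral_reduce)
  qed
  have V_deriv: "(V has_real_derivative V' x) (at x)" for x
  proof -
    have "((\<lambda>x. x\<^sup>2 - c) has_real_derivative 2 * x) (at x)" by (auto intro!: derivative_eq_intros)
    from DERIV_chain2[OF has_derivative_max_0_square this]
    have "((\<lambda>x. (max 0 (x\<^sup>2 - c))\<^sup>2) has_real_derivative 2 * max 0 (x\<^sup>2 - c) * (2 * x)) (at x)" .
    moreover have "((\<lambda>x. K / 2 * x\<^sup>2 + \<beta>2 * x) has_real_derivative K * x + \<beta>2) (at x)"
      by (auto intro!: derivative_eq_intros)
    ultimately show ?thesis
      unfolding V_def[abs_def] V'_def
      by (intro DERIV_cong[OF DERIV_diff[OF DERIV_add DERIV_const]]) (auto simp: mult_ac)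
  qed
  have V_convex: "V x + V' x * (y - x) + K / 2 * (y - x)\<^sup>2 \<le> V y" for x y
  proof -
    define p where "p = max 0 (x\<^sup>2 - c)"
    define q where "q = max 0 (y\<^sup>2 - c)"
    \<comment> \<open>The tangent line inequality for the convex function \<open>(max 0 (x\<^sup>2 - c))\<^sup>2\<close>, in the notation
      \<open>p\<close>, \<open>q\<close> for its square root at the two points.\<close>
    have "p * (2 * x * (y - x)) \<le> p * (q - p)"
    proof (cases "x\<^sup>2 \<le> c")
      case False
      have "0 \<le> (y - x)\<^sup>2" by simp
      then have "2 * x * (y - x) \<le> y\<^sup>2 - x\<^sup>2" by (simp add: power2_eq_square algebra_simps)
      also have "\<dots> \<le> q - p" using False by (simp add: p_def q_def)
      finally show ?thesis by (intro mult_left_mono) (auto simp: p_def)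
    qed (simp add: p_def)
    moreover have "p\<^sup>2 + 2 * (p * (q - p)) \<le> q\<^sup>2"
      using zero_le_power2[of "q - p"] by (simp add: power2_eq_square algebra_simps)
    ultimately have "p\<^sup>2 + 4 * x * p * (y - x) \<le> q\<^sup>2" by (simp add: algebra_simps)
    moreover have "V x = K / 2 * x\<^sup>2 + \<beta>2 * x + p\<^sup>2 - c\<^sup>2" "V y = K / 2 * y\<^sup>2 + \<beta>2 * y + q\<^sup>2 - c\<^sup>2"
      "V' x = K * x + \<beta>2 + 4 * x * p"
      by (simp_all add: V_def V'_def p_def q_def)
    ultimately show ?thesis by (simp add: power2_eq_square field_simps)
  qed
  have h_le: "h x \<le> c\<^sup>2" for x
  proof -
    have "\<bar>min 0 (x\<^sup>2 - c)\<bar> \<le> \<bar>c\<bar>" using c0 by (simp add: min_def)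
    then show ?thesis unfolding h_def by (simp only: abs_le_square_iff)
  qed
  have "\<forall>f\<in>test_functions. K * exp (- c\<^sup>2) * Ent (gibbs (quartic \<beta>1 \<beta>2)) (\<lambda>x. (f x)\<^sup>2)
      \<le> 2 * dirichlet_form (quartic \<beta>1 \<beta>2) f"
  proof
    fix f assume f: "f \<in> test_functions"
    have "Ent (gibbs (quartic \<beta>1 \<beta>2)) (\<lambda>x. (f x)\<^sup>2) \<le> 2 * exp (c\<^sup>2) / K * dirichlet_form (quartic \<beta>1 \<beta>2) f"
    proof (rule log_sobolev_from_intervals[OF _ f])
      fix n :: nat and f f' :: "real \<Rightarrow> real"
      assume n: "0 < n" and f: "\<And>x. (f has_real_derivative f' x) (at x)" "continuous_on UNIV f'"
      have "continuous_on UNIV V'" "continuous_on UNIV h"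
        unfolding V'_def h_def by (intro continuous_intros)+
      then show "interval_entropy (- real n) (real n) (\<lambda>x. exp (- quartic \<beta>1 \<beta>2 x)) (\<lambda>x. (f x)\<^sup>2)
          \<le> 2 * exp (c\<^sup>2) / K * integral {- real n..real n} (\<lambda>x. (f' x)\<^sup>2 * exp (- quartic \<beta>1 \<beta>2 x))"
        unfolding decomposition using n
        by (intro interval_log_sobolev_perturbed[OF _ K V_deriv V_convex _ _ _ h_le f]) (auto simp: h_def)
    qed
    then have "K * exp (- c\<^sup>2) * Ent (gibbs (quartic \<beta>1 \<beta>2)) (\<lambda>x. (f x)\<^sup>2)
        \<le> K * exp (- c\<^sup>2) * (2 * exp (c\<^sup>2) / K * dirichlet_form (quartic \<beta>1 \<beta>2) f)"
      using K by (intro mult_left_mono) auto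
    also have "\<dots> = 2 * dirichlet_form (quartic \<beta>1 \<beta>2) f"
      using K by (simp add: exp_minus)
    finally show "K * exp (- c\<^sup>2) * Ent (gibbs (quartic \<beta>1 \<beta>2)) (\<lambda>x. (f x)\<^sup>2) \<le> 2 * dirichlet_form (quartic \<beta>1 \<beta>2) f" .
  qed
  then have "K * exp (- c\<^sup>2) \<le> log_sobolev (quartic \<beta>1 \<beta>2)" by (rule log_sobolev_upper)
  moreover have "c\<^sup>2 = (\<beta>1 + K / 2)\<^sup>2 / 4" by (simp add: c_def power_divide)
  ultimately show ?thesis by simp
qed

lemma sqrt_exp_1: "sqrt (exp 1) = exp (1 / 2 :: real)"
  by (rule real_sqrt_unique) (simp_all add: power2_eq_square flip: exp_add)

lemma four_le_exp_2: "4 \<le> exp (2 :: real)"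
proof -
  have "2\<^sup>2 \<le> (exp 1 :: real)\<^sup>2" using exp_ge_add_one_self[of "1::real"] by (intro power_mono) auto
  then show ?thesis by (simp flip: exp_of_nat_mult)
qed

text \<open>The choice \<open>K = sqrt(\<beta>1\<^sup>2 + 8) - \<beta>1\<close> is the positive root of \<open>K (\<beta>1 + K/2) = 4\<close>, where
\<open>K exp(-(\<beta>1 + K/2)\<^sup>2/4)\<close> is maximal.\<close>

lemma log_sobolev_quartic_lower_bound:
  assumes "0 \<le> \<beta>1"
  shows "(sqrt (\<beta>1\<^sup>2 + 8) - \<beta>1) / sqrt (exp 1) * exp (- (1/8) * \<beta>1 * (\<beta>1 + sqrt (\<beta>1\<^sup>2 + 8)))
    \<le> log_sobolev (quartic \<beta>1 \<beta>2)"
proof -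
  define s where "s = sqrt (\<beta>1\<^sup>2 + 8)"
  have s2: "s\<^sup>2 = \<beta>1\<^sup>2 + 8" unfolding s_def by (rule real_sqrt_pow2) (simp add: add_nonneg_nonneg)
  have s: "\<beta>1 < s" unfolding s_def by (rule real_less_rsqrt) simp
  have "(\<beta>1 + (s - \<beta>1) / 2)\<^sup>2 / 4 = (\<beta>1\<^sup>2 + 2 * \<beta>1 * s + s\<^sup>2) / 16" by (simp add: power2_eq_square field_simps)
  also have "\<dots> = 1 / 2 + 1 / 8 * \<beta>1 * (\<beta>1 + s)"
    unfolding s2 by (simp add: power2_eq_square field_simps)
  finally have "(s - \<beta>1) / sqrt (exp 1) * exp (- (1/8) * \<beta>1 * (\<beta>1 + s))
      = (s - \<beta>1) * exp (- (\<beta>1 + (s - \<beta>1) / 2)\<^sup>2 / 4)"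
    by (simp add: sqrt_exp_1 exp_diff exp_minus field_simps flip: exp_add)
  also have "\<dots> \<le> log_sobolev (quartic \<beta>1 \<beta>2)"
    by (rule log_sobolev_quartic_ge) (use s assms in auto)
  finally show ?thesis by (simp add: s_def)
qed

text \<open>For \<open>\<beta>2 = 0\<close> the potential is a symmetric double well with minima at \<open>\<plusminus>sqrt(\<beta>/2)\<close> and a
barrier of height \<open>\<beta>\<^sup>2/4\<close> at \<open>0\<close>. On the scale \<open>\<delta> = 1/(2 sqrt(1 + \<beta>))\<close> the potential is at least
\<open>-1/4\<close> around the barrier, and at distance \<open>\<delta>\<close> to \<open>2\<delta>\<close> beyond a minimum it exceeds its
minimal value by at most \<open>9\<close>. The ratio of energy to variance for the step across the barrier is
therefore of order at most \<open>(1 + \<beta>) exp(-\<beta>\<^sup>2/4)\<close>. The exponents \<open>1/4\<close> and \<open>9\<close> and the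
\<open>8/3\<close> from the squared slope of the step add up to \<open>143/12\<close>; the remaining factor \<open>4\<close> is less than
\<open>exp(14 - 143/12)\<close>.\<close>

lemma spectral_gap_quartic_upper_bound:
  assumes \<beta>: "0 \<le> \<beta>"
  shows "spectral_gap (quartic \<beta> 0) \<le> 4 * exp 14 * exp (- (1/4) * \<beta>\<^sup>2 + 2 * ln (1 + \<beta>))"
proof -
  interpret gibbs_potential "quartic \<beta> 0" by (rule quartic_gibbs_potential)
  define \<kappa> where "\<kappa> = spectral_gap (quartic \<beta> 0)"
  have \<kappa>0: "0 \<le> \<kappa>"
    unfolding \<kappa>_def by (rule spectral_gap_upper) (simp add: dirichlet_form_nonneg)
  define \<delta> where "\<delta> = 1 / (2 * sqrt (1 + \<beta>))"
  define x0 where "x0 = sqrt (\<beta> / 2)"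
  have \<delta>: "0 < \<delta>" using \<beta> by (simp add: \<delta>_def)
  have \<delta>2: "\<delta>\<^sup>2 = 1 / (4 * (1 + \<beta>))" using \<beta> by (simp add: \<delta>_def power_divide power_mult_distrib)
  have \<delta>2_le: "\<delta>\<^sup>2 \<le> 1 / 4" using \<beta> by (simp add: \<delta>2 field_simps)
  have x0: "0 \<le> x0" "x0\<^sup>2 = \<beta> / 2" using \<beta> by (simp_all add: x0_def)
  have \<delta>x0: "2 * \<delta> * x0 \<le> 1"
  proof -
    have "x0 \<le> sqrt (1 + \<beta>)" unfolding x0_def using \<beta> by (intro real_sqrt_le_mono) simp
    then show ?thesis using \<beta> by (simp add: \<delta>_def field_simps)
  qed
  have quartic: "quartic \<beta> 0 x = (x\<^sup>2 - \<beta> / 2)\<^sup>2 - \<beta>\<^sup>2 / 4" for x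
    by (simp add: quartic_def power2_eq_square field_simps power_numeral_reduce)
  have "\<kappa> * (exp (\<beta>\<^sup>2 / 4 - 9) * \<delta>) \<le> exp (1 / 4) * (2 * exp (4 / 3))\<^sup>2 / \<delta>"
  proof (rule poincare_constant_le[of \<kappa> \<delta> "x0 + \<delta>"])
    show "\<forall>f\<in>test_functions. \<kappa> * variance f \<le> dirichlet_form (quartic \<beta> 0) f"
      unfolding \<kappa>_def by (rule spectral_gap_admissible)
    show "exp (\<beta>\<^sup>2 / 4 - 9) \<le> exp (- quartic \<beta> 0 x)" if x: "x0 + \<delta> \<le> \<bar>x\<bar>" "\<bar>x\<bar> \<le> x0 + \<delta> + \<delta>" for x
    proof -
      define r where "r = \<bar>x\<bar> - x0"
      have r: "0 \<le> r" "r \<le> 2 * \<delta>" using x \<delta> by (auto simp: r_def)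
      have "x\<^sup>2 = (x0 + r)\<^sup>2" by (simp add: r_def)
      then have eq: "x\<^sup>2 - \<beta> / 2 = r * (2 * x0 + r)"
        by (simp add: power2_sum x0(2)) (simp add: power2_eq_square algebra_simps)
      have "r * (2 * x0 + r) \<le> 2 * \<delta> * (2 * x0 + 2 * \<delta>)"
        using r x0(1) \<delta> by (intro mult_mono) auto
      also have "\<dots> = 2 * (2 * \<delta> * x0) + 4 * \<delta>\<^sup>2" by (simp add: power2_eq_square algebra_simps)
      also have "\<dots> \<le> 3" using \<delta>x0 \<delta>2_le by simp
      finally have "(x\<^sup>2 - \<beta> / 2)\<^sup>2 \<le> 3\<^sup>2"
        unfolding eq using r x0 by (intro power_mono) auto
      then show ?thesis by (simp add: quartic)
    qed
    show "exp (- quartic \<beta> 0 x) \<le> exp (1 / 4)" if x: "\<bar>x\<bar> \<le> \<delta>" for x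
    proof -
      have "x\<^sup>2 \<le> \<delta>\<^sup>2" using power_mono[OF x, of 2] by simp
      then have "\<beta> * x\<^sup>2 \<le> \<beta> * \<delta>\<^sup>2" using \<beta> by (rule mult_left_mono)
      also have "\<dots> \<le> 1 / 4" using \<beta> by (simp add: \<delta>2 field_simps)
      also have "1 / 4 \<le> x ^ 4 + 1 / 4" by (simp add: zero_le_even_power)
      finally have "\<beta> * x\<^sup>2 - x ^ 4 \<le> 1 / 4" by linarith
      then show ?thesis by (simp add: quartic_def)
    qed
  qed (use \<kappa>0 \<delta> x0 in auto)
  then have "\<kappa> * exp (\<beta>\<^sup>2 / 4 - 9) * \<delta>\<^sup>2 \<le> exp (1 / 4) * (2 * exp (4 / 3))\<^sup>2"
    using \<delta> by (simp add: field_simps power2_eq_square)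
  then have "\<kappa> * exp (\<beta>\<^sup>2 / 4 - 9) \<le> exp (1 / 4) * (2 * exp (4 / 3))\<^sup>2 * (4 * (1 + \<beta>))"
    using \<beta> by (simp add: \<delta>2 field_simps)
  then have "\<kappa> * exp (\<beta>\<^sup>2 / 4 - 9) * exp (9 - \<beta>\<^sup>2 / 4)
      \<le> exp (1 / 4) * (2 * exp (4 / 3))\<^sup>2 * (4 * (1 + \<beta>)) * exp (9 - \<beta>\<^sup>2 / 4)"
    by (intro mult_right_mono) auto
  then have "\<kappa> \<le> exp (1 / 4) * (2 * exp (4 / 3))\<^sup>2 * (4 * (1 + \<beta>)) * exp (9 - \<beta>\<^sup>2 / 4)"
    by (simp add: mult.assoc flip: exp_add)
  also have "\<dots> = 16 * (exp (1 / 4) * exp (4 / 3) * exp (4 / 3) * exp 9) * (1 + \<beta>) * exp (- \<beta>\<^sup>2 / 4)"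
  proof -
    have "exp (9 - \<beta>\<^sup>2 / 4) = exp 9 * exp (- \<beta>\<^sup>2 / 4)" by (simp flip: exp_add)
    then show ?thesis by (simp only: power_mult_distrib power2_eq_square[of "exp (4 / 3)"]) simp
  qed
  also have "exp (1 / 4) * exp (4 / 3) * exp (4 / 3) * exp 9 = exp (143 / 12 :: real)"
    by (simp flip: exp_add)
  also have "16 * exp (143 / 12) * (1 + \<beta>) * exp (- \<beta>\<^sup>2 / 4) \<le> 4 * exp 14 * (1 + \<beta>)\<^sup>2 * exp (- \<beta>\<^sup>2 / 4)"
  proof (rule mult_right_mono, rule mult_mono)
    have "4 * exp (143 / 12) \<le> exp 2 * exp (143 / 12 :: real)" by (intro mult_right_mono four_le_exp_2) auto
    also have "\<dots> = exp (2 + 143 / 12)" by (simp only: exp_add)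
    also have "\<dots> \<le> exp 14" by simp
    finally show "16 * exp (143 / 12) \<le> 4 * exp (14 :: real)" by simp
    show "1 + \<beta> \<le> (1 + \<beta>)\<^sup>2" using \<beta> by (simp add: power2_eq_square)
  qed (use \<beta> in auto)
  also have "\<dots> = 4 * exp 14 * exp (- (1/4) * \<beta>\<^sup>2 + 2 * ln (1 + \<beta>))"
  proof -
    have "exp (2 * ln (1 + \<beta>)) = (1 + \<beta>)\<^sup>2"
      using \<beta> by (simp add: exp_double)
    then show ?thesis unfolding exp_add by simp
  qed
  finally show ?thesis by (simp add: \<kappa>_def)
qed

text \<open>With \<open>s = sqrt(\<beta>\<^sup>2 + 8)\<close>, the identity \<open>(s - \<beta>)(s + \<beta>) = 8\<close> shows that the prefactor \<open>s - \<beta>\<close>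
of the lower bound is of order \<open>1/\<beta>\<close> and that \<open>\<beta>(\<beta> + s)/8\<close> exceeds \<open>\<beta>\<^sup>2/4\<close> by at most
\<open>1/2\<close>. Hence both bounds agree with \<open>exp(-\<beta>\<^sup>2/4)\<close> up to factors that are powers of \<open>\<beta>\<close>.\<close>

lemma exp_quarter_square_formI:
  assumes lower: "\<And>\<beta>. 0 \<le> \<beta> \<Longrightarrow>
      (sqrt (\<beta>\<^sup>2 + 8) - \<beta>) / sqrt (exp 1) * exp (- (1/8) * \<beta> * (\<beta> + sqrt (\<beta>\<^sup>2 + 8))) \<le> F \<beta>"
    and upper: "\<And>\<beta>. 0 \<le> \<beta> \<Longrightarrow> F \<beta> \<le> 4 * exp 14 * exp (- (1/4) * \<beta>\<^sup>2 + 2 * ln (1 + \<beta>))"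
  shows "exp_quarter_square_form F"
  unfolding exp_quarter_square_form_def
proof (intro exI conjI)
  let ?r = "\<lambda>\<beta>. ln (F \<beta>) + \<beta>\<^sup>2 / 4"
  have bounds: "0 < F \<beta> \<and> \<bar>?r \<beta>\<bar> \<le> 20 * ln \<beta>" if \<beta>: "3 \<le> \<beta>" for \<beta>
  proof -
    define s where "s = sqrt (\<beta>\<^sup>2 + 8)"
    have s2: "s\<^sup>2 = \<beta>\<^sup>2 + 8" unfolding s_def by (rule real_sqrt_pow2) (simp add: add_nonneg_nonneg)
    have s: "\<beta> < s" unfolding s_def by (rule real_less_rsqrt) simp
    have "9 \<le> \<beta>\<^sup>2" using power_mono[OF \<beta>, of 2] by simp
    then have "s \<le> 3 * \<beta>" unfolding s_def using \<beta> by (intro real_le_lsqrt) (auto simp: power_mult_distrib)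
    have prod: "(s - \<beta>) * (s + \<beta>) = 8" using s2 by (simp add: power2_eq_square algebra_simps)
    have s_ge: "1 / \<beta> \<le> s - \<beta>"
    proof -
      have "8 \<le> (s - \<beta>) * (4 * \<beta>)"
        unfolding prod[symmetric] using s \<open>s \<le> 3 * \<beta>\<close> by (intro mult_left_mono) auto
      then show ?thesis using \<beta> by (simp add: field_simps)
    qed
    have exponent: "- \<beta>\<^sup>2 / 4 - 1 / 2 \<le> - (1/8) * \<beta> * (\<beta> + s)"
    proof -
      have "(s - \<beta>) * (2 * \<beta>) \<le> 8"
        unfolding prod[symmetric] using s by (intro mult_left_mono) auto
      then show ?thesis by (simp add: power2_eq_square field_simps)
    qed
    have "exp (- ln \<beta> - 1 / 2 + (- \<beta>\<^sup>2 / 4 - 1 / 2)) = 1 / \<beta> / sqrt (exp 1) * exp (- \<beta>\<^sup>2 / 4 - 1 / 2)"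
      unfolding exp_add exp_diff sqrt_exp_1 using \<beta> by (simp add: exp_minus field_simps)
    also have "\<dots> \<le> (s - \<beta>) / sqrt (exp 1) * exp (- (1/8) * \<beta> * (\<beta> + s))"
      using s_ge exponent s by (intro mult_mono divide_right_mono) auto
    also have "\<dots> \<le> F \<beta>" using lower[of \<beta>] \<beta> by (simp add: s_def)
    finally have low: "exp (- ln \<beta> - 1 / 2 + (- \<beta>\<^sup>2 / 4 - 1 / 2)) \<le> F \<beta>" .
    then have pos: "0 < F \<beta>" by (rule less_le_trans[OF exp_gt_zero])
    have ln_ge_1: "1 \<le> ln \<beta>"
    proof -
      have "exp 1 \<le> \<beta>" using exp_le \<beta> by linarith
      then show ?thesis using \<beta> by (simp add: ln_ge_iff)
    qed
    have "- ln \<beta> - 1 / 2 + (- \<beta>\<^sup>2 / 4 - 1 / 2) \<le> ln (F \<beta>)"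
      using low pos by (simp add: ln_ge_iff)
    moreover have "ln (F \<beta>) \<le> ln 4 + 14 + (- (1/4) * \<beta>\<^sup>2 + 2 * ln (1 + \<beta>))"
    proof -
      have "ln (F \<beta>) \<le> ln (4 * exp 14 * exp (- (1/4) * \<beta>\<^sup>2 + 2 * ln (1 + \<beta>)))"
        using upper[of \<beta>] \<beta> pos by (intro ln_mono) auto
      then show ?thesis by (simp add: ln_mult)
    qed
    moreover have "ln (1 + \<beta>) \<le> 2 * ln \<beta>"
    proof -
      have "3 * \<beta> \<le> \<beta> * \<beta>" using \<beta> by (intro mult_right_mono) auto
      then have "1 + \<beta> \<le> \<beta>\<^sup>2" unfolding power2_eq_square using \<beta> by linarith
      then have "ln (1 + \<beta>) \<le> ln (\<beta>\<^sup>2)" using \<beta> by (intro ln_mono) auto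
      then show ?thesis using \<beta> by (simp add: ln_realpow)
    qed
    moreover have "ln 4 \<le> (2::real)"
      using ln_mono[OF four_le_exp_2] by simp
    ultimately show ?thesis using pos ln_ge_1 by (simp add: abs_le_iff)
  qed
  show "?r \<in> O[at_top](ln)"
  proof (rule bigoI[of _ 20])
    show "\<forall>\<^sub>F \<beta> in at_top. norm (?r \<beta>) \<le> 20 * norm (ln \<beta>)"
      using eventually_ge_at_top[of 3] by eventually_elim (use bounds in force)
  qed
  show "\<forall>\<^sub>F \<beta> in at_top. F \<beta> = exp (- \<beta>\<^sup>2 / 4 + ?r \<beta>)"
    using eventually_ge_at_top[of 3] by eventually_elim (use bounds in simp)
qed

theorem proposition1p4:
  shows "(\<forall>\<beta>1\<ge>0.
      4 * exp 14 * exp (- (1/4) * \<beta>1\<^sup>2 + 2 * ln (1 + \<beta>1)) \<ge> (INF \<beta>2. spectral_gap (quartic \<beta>1 \<beta>2))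
    \<and> (INF \<beta>2. spectral_gap (quartic \<beta>1 \<beta>2)) \<ge> (INF \<beta>2. log_sobolev (quartic \<beta>1 \<beta>2))
    \<and> (INF \<beta>2. log_sobolev (quartic \<beta>1 \<beta>2)) \<ge>
        (sqrt (\<beta>1\<^sup>2 + 8) - \<beta>1) / sqrt (exp 1) * exp (- (1/8) * \<beta>1 * (\<beta>1 + sqrt (\<beta>1\<^sup>2 + 8))))
  \<and> exp_quarter_square_form (\<lambda>\<beta>1. INF \<beta>2. spectral_gap (quartic \<beta>1 \<beta>2))
  \<and> exp_quarter_square_form (\<lambda>\<beta>1. INF \<beta>2. log_sobolev (quartic \<beta>1 \<beta>2))"
proof -
  let ?gap = "\<lambda>\<beta>1. INF \<beta>2. spectral_gap (quartic \<beta>1 \<beta>2)"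
  let ?lsi = "\<lambda>\<beta>1. INF \<beta>2. log_sobolev (quartic \<beta>1 \<beta>2)"
  have lsi_le: "log_sobolev (quartic \<beta>1 \<beta>2) \<le> spectral_gap (quartic \<beta>1 \<beta>2)" for \<beta>1 \<beta>2
    by (rule gibbs_potential.log_sobolev_le_spectral_gap[OF quartic_gibbs_potential])
  have lower: "(sqrt (\<beta>1\<^sup>2 + 8) - \<beta>1) / sqrt (exp 1) * exp (- (1/8) * \<beta>1 * (\<beta>1 + sqrt (\<beta>1\<^sup>2 + 8))) \<le> ?lsi \<beta>1"
    if "0 \<le> \<beta>1" for \<beta>1
    using log_sobolev_quartic_lower_bound[OF that] by (intro cINF_greatest) auto
  have bdd: "bdd_below (range (\<lambda>\<beta>2. log_sobolev (quartic \<beta>1 \<beta>2)))" if "0 \<le> \<beta>1" for \<beta>1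
    using log_sobolev_quartic_lower_bound[OF that] by (intro bdd_belowI2)
  have middle: "?lsi \<beta>1 \<le> ?gap \<beta>1" if "0 \<le> \<beta>1" for \<beta>1
    using bdd[OF that] lsi_le by (intro cINF_mono) auto
  have upper: "?gap \<beta>1 \<le> 4 * exp 14 * exp (- (1/4) * \<beta>1\<^sup>2 + 2 * ln (1 + \<beta>1))" if "0 \<le> \<beta>1" for \<beta>1
  proof -
    have "bdd_below (range (\<lambda>\<beta>2. spectral_gap (quartic \<beta>1 \<beta>2)))"
      using order_trans[OF log_sobolev_quartic_lower_bound[OF that] lsi_le] by (intro bdd_belowI2)
    then have "?gap \<beta>1 \<le> spectral_gap (quartic \<beta>1 0)" by (rule cINF_lower) simp
    then show ?thesis using spectral_gap_quartic_upper_bound[OF that] by (rule order_trans)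
  qed
  have "exp_quarter_square_form ?gap"
    using order_trans[OF lower middle] upper by (intro exp_quarter_square_formI)
  moreover have "exp_quarter_square_form ?lsi"
    using lower order_trans[OF middle upper] by (intro exp_quarter_square_formI)
  ultimately show ?thesis using upper middle lower by simp
qed

end
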